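(* Let $\mathsf{FAMMV}_2\subseteq\mathcal{A}$ be the $\mathbb{Q}$-vector space generated by all finite alternating multiple mixed values of weight $2$. Then $$\mathsf{FAMMV}_2=\big\langle\, \mathtt{q}_2^2,\ G_{\mathcal A},\ (-1)^{p'}\mathtt{q}_2^2,\ (-1)^{p'}G_{\mathcal A}\,\big\rangle_{\mathbb{Q}},$$ i.e. $\mathsf{FAMMV}_2$ is the $\mathbb{Q}$-linear span of these four elements of $\mathcal A$.
   Context: Let $\mathcal{P}$ be the set of primes and $\mathcal{A}=\prod_{p\in\mathcal P}(\mathbb{Z}/p\mathbb{Z})\big/\bigoplus_{p\in\mathcal P}(\mathbb{Z}/p\mathbb{Z})$, a $\mathbb{Q}$-algebra; an element is represented by a family of residues mod $p$ defined for all but finitely many $p$, and two families are equal iff they agree for all but finitely many $p$. Finite alternating multiple mixed values: for $\mathbf{s}=(s_1,\dots,s_d)\in\mathbb{N}^d$ (positive integers), $\boldsymbol\varepsilon=(\varepsilon_1,\dots,\varepsilon_d)\in\{\pm1\}^d$, $\boldsymbol\sigma=(\sigma_1,\dots,\sigma_d)\in\{\pm1\}^d$, let $$M_{\mathcal A}(\mathbf{s};\boldsymbol\varepsilon;\boldsymbol\sigma)=\Bigg(\sum_{\substack{p>k_1>\cdots>k_d>0\\ k_j \text{ even if }\varepsilon_j=1,\ k_j\text{ odd if }\varepsilon_j=-1}}\ \prod_{j=1}^d\frac{\sigma_j^{(2k_j+1-\varepsilon_j)/4}}{k_j^{s_j}} \bmod p\Bigg)_{p\in\mathcal P}\in\mathcal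 A .$$ (So the exponent of $\sigma_j$ is $k_j/2$ if $\varepsilon_j=1$ and $(k_j+1)/2$ if $\varepsilon_j=-1$.) Its weight is $s_1+\cdots+s_d$; the depth $d$ is arbitrary. $\mathtt{q}_2=\big((2^{p-1}-1)/p \bmod p\big)_{p>2}\in\mathcal A$. The Euler numbers $E_n$ are defined by $\frac{2}{e^t+e^{-t}}=\sum_{n\ge0}E_n\frac{t^n}{n!}$, and $G_{\mathcal A}=\big(E_{p-3}/2 \bmod p\big)_{p>3}\in\mathcal A$. Finally $(-1)^{p'}$ denotes the element $\big((-1)^{(p-1)/2}\big)_{p\ge3}\in\mathcal A$. *)

theory Defs
  imports
    "HOL-Number_Theory.Modular_Inverse"
    "HOL-Computational_Algebra.Computational_Algebra"
begin

section \<open>Reduction of rationals modulo a prime\<close>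

text \<open>
  \<^term>\<open>residue p r\<close> represents \<open>r mod p\<close> whenever the prime \<open>p\<close> does not divide the denominator
  of \<open>r\<close>; otherwise it is a junk value.
\<close>
definition residue :: "nat \<Rightarrow> rat \<Rightarrow> int" where
  "residue p r = fst (quotient_of r) * modular_inverse (int p) (snd (quotient_of r))"

lemma residue_cong:
  fixes a b :: int
  assumes p: "prime p" and b: "\<not> int p dvd b" and r: "r = of_int a / of_int b"
  shows "[residue p r * b = a] (mod int p)"
proof -
  obtain n d where nd: "quotient_of r = (n, d)" by fastforce
  have d0: "d > 0" and cop: "coprime n d" and rnd: "r = of_int n / of_int d"
    using nd quotient_of_denom_pos quotient_of_coprime quotient_of_div by blast+
  have b0: "b \<noteq> 0" using b by auto
  have "of_int (n * b) = (of_int (a * d) :: rat)"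
    using r rnd b0 d0 by (simp add: field_simps)
  hence eq: "n * b = a * d" by (simp only: of_int_eq_iff)
  have "d dvd b" using eq cop
    by (metis coprime_commute coprime_dvd_mult_right_iff dvd_triv_right)
  hence "\<not> int p dvd d" using b dvd_trans by blast
  hence c: "coprime d (int p)"
    using p by (metis coprime_commute prime_imp_coprime prime_nat_int_transfer)
  have "[residue p r * d = n * (d * modular_inverse (int p) d)] (mod int p)"
    by (simp add: residue_def nd mult_ac)
  also have "[n * (d * modular_inverse (int p) d) = n * 1] (mod int p)"
    by (intro cong_mult cong_refl cong_modular_inverse1 c)
  finally have "[residue p r * d * b = n * 1 * b] (mod int p)"
    by (rule cong_mult[OF _ cong_refl])
  hence "[residue p r * b * d = a * d] (mod int p)"
    using eq by (simp add: mult_ac)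
  thus ?thesis using c cong_mult_rcancel by blast
qed

lemma eventually_not_dvd:
  assumes "b \<noteq> (0::int)"
  shows "\<forall>\<^sub>F p in cofinite. \<not> int p dvd b"
proof -
  have "{p. int p dvd b} \<subseteq> {..nat \<bar>b\<bar>}"
    using assms by (auto simp: le_nat_iff dest: dvd_imp_le_int)
  thus ?thesis by (auto simp: eventually_cofinite intro: finite_subset)
qed

lemma residue_cancel:
  assumes "prime p" "\<not> int p dvd b" "[x * b = y * b] (mod int p)"
  shows "[x = y] (mod int p)"
  using assms
  by (meson cong_mult_rcancel coprime_commute prime_imp_coprime prime_nat_int_transfer)

lemma rat_fraction: obtains a b :: int where "b \<noteq> 0" "r = (of_int a / of_int b :: rat)"
  by (metis Fract_of_int_quotient Rat_cases less_irrefl)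

lemma residue_add:
  "\<forall>\<^sub>F p in cofinite. prime p \<longrightarrow> [residue p (r + s) = residue p r + residue p s] (mod int p)"
proof -
  obtain a b where r: "b \<noteq> 0" "r = of_int a / of_int b" by (rule rat_fraction)
  obtain c d where s: "d \<noteq> 0" "s = of_int c / of_int d" by (rule rat_fraction)
  have "b * d \<noteq> 0" using r s by simp
  from eventually_not_dvd[OF this] show ?thesis
  proof eventually_elim
    case (elim p)
    show ?case
    proof
      assume p: "prime p"
      have "\<not> int p dvd b" "\<not> int p dvd d" using elim by auto
      note R = residue_cong[OF p this(1) r(2)] and S = residue_cong[OF p this(2) s(2)]
      have "[residue p (r + s) * (b * d) = a * d + c * b] (mod int p)"
        by (rule residue_cong[OF p elim]) (use r s in \<open>simp add: field_simps\<close>)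
      also have "[a * d + c * b = residue p r * b * d + residue p s * d * b] (mod int p)"
        by (intro cong_add cong_mult cong_refl cong_sym[OF R] cong_sym[OF S])
      finally have "[residue p (r + s) * (b * d)
          = (residue p r + residue p s) * (b * d)] (mod int p)"
        by (simp add: algebra_simps)
      thus "[residue p (r + s) = residue p r + residue p s] (mod int p)"
        by (rule residue_cancel[OF p elim])
    qed
  qed
qed

lemma residue_mult:
  "\<forall>\<^sub>F p in cofinite. prime p \<longrightarrow> [residue p (r * s) = residue p r * residue p s] (mod int p)"
proof -
  obtain a b where r: "b \<noteq> 0" "r = of_int a / of_int b" by (rule rat_fraction)
  obtain c d where s: "d \<noteq> 0" "s = of_int c / of_int d" by (rule rat_fraction)
  have "b * d \<noteq> 0" using r s by simp
  from eventually_not_dvd[OF this] show ?thesis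
  proof eventually_elim
    case (elim p)
    show ?case
    proof
      assume p: "prime p"
      have "\<not> int p dvd b" "\<not> int p dvd d" using elim by auto
      note R = residue_cong[OF p this(1) r(2)] and S = residue_cong[OF p this(2) s(2)]
      have "[residue p (r * s) * (b * d) = a * c] (mod int p)"
        by (rule residue_cong[OF p elim]) (use r s in \<open>simp add: field_simps\<close>)
      also have "[a * c = (residue p r * b) * (residue p s * d)] (mod int p)"
        by (intro cong_mult cong_sym[OF R] cong_sym[OF S])
      finally have "[residue p (r * s) * (b * d)
          = (residue p r * residue p s) * (b * d)] (mod int p)"
        by (simp add: algebra_simps)
      thus "[residue p (r * s) = residue p r * residue p s] (mod int p)"
        by (rule residue_cancel[OF p elim])
    qed
  qed
qed

lemma residue_1: "prime p \<Longrightarrow> residue p 1 = 1"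
  using prime_gt_1_nat[of p] by (simp add: residue_def)


section \<open>The \<open>\<rat>\<close>-algebra \<open>\<A>\<close>\<close>

text \<open>
  A family of residues modulo the primes is represented by a function \<open>f\<close>, of which only the classes
  \<open>f p mod p\<close> at primes \<open>p\<close> matter, and these only up to finitely many exceptions.
\<close>
definition almost_cong :: "(nat \<Rightarrow> int) \<Rightarrow> (nat \<Rightarrow> int) \<Rightarrow> bool" where
  "almost_cong f g \<longleftrightarrow> (\<forall>\<^sub>F p in cofinite. prime p \<longrightarrow> [f p = g p] (mod int p))"

quotient_type adele = "nat \<Rightarrow> int" / almost_cong
proof (rule equivpI)
  show "reflp almost_cong" by (auto simp: reflp_def almost_cong_def)
  show "symp almost_cong" by (auto simp: symp_def almost_cong_def cong_sym_eq)
  show "transp almost_cong" unfolding transp_def almost_cong_def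
    by (auto elim: eventually_elim2 intro: cong_trans)
qed

lift_definition adele_of :: "(nat \<Rightarrow> int) \<Rightarrow> adele" is "\<lambda>f. f" .

instantiation adele :: comm_ring_1
begin

lift_definition zero_adele :: adele is "\<lambda>p. 0" .
lift_definition one_adele :: adele is "\<lambda>p. 1" .

lift_definition plus_adele :: "adele \<Rightarrow> adele \<Rightarrow> adele" is "\<lambda>f g p. f p + g p"
  unfolding almost_cong_def by (erule (1) eventually_elim2) (auto intro: cong_add)

lift_definition times_adele :: "adele \<Rightarrow> adele \<Rightarrow> adele" is "\<lambda>f g p. f p * g p"
  unfolding almost_cong_def by (erule (1) eventually_elim2) (auto intro: cong_mult)

lift_definition uminus_adele :: "adele \<Rightarrow> adele" is "\<lambda>f p. - f p"
  unfolding almost_cong_def by (simp add: cong_minus_minus_iff)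

lift_definition minus_adele :: "adele \<Rightarrow> adele \<Rightarrow> adele" is "\<lambda>f g p. f p - g p"
  unfolding almost_cong_def by (erule (1) eventually_elim2) (auto intro: cong_diff)

instance
proof
  show "(0::adele) \<noteq> 1"
  proof (transfer, unfold almost_cong_def, rule notI)
    assume "\<forall>\<^sub>F p in cofinite. prime p \<longrightarrow> [0 = 1] (mod int p)"
    hence "\<forall>\<^sub>F p::nat in cofinite. \<not> prime p"
      by (rule eventually_mono) (auto simp: cong_def dest: prime_gt_1_nat)
    hence "finite {p::nat. prime p}" by (simp add: eventually_cofinite)
    thus False using primes_infinite by simp
  qed
qed (transfer; simp add: almost_cong_def algebra_simps)+

end

lift_definition adele_scale :: "rat \<Rightarrow> adele \<Rightarrow> adele" is "\<lambda>r f p. residue p r * f p"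
  unfolding almost_cong_def by (erule eventually_mono) (auto intro: cong_mult)

interpretation adele: vector_space adele_scale
proof
  fix r s :: rat and x y :: adele
  show "adele_scale r (x + y) = adele_scale r x + adele_scale r y"
    by transfer (simp add: almost_cong_def algebra_simps)
  show "adele_scale (r + s) x = adele_scale r x + adele_scale s x"
  proof (transfer, unfold almost_cong_def)
    fix r s and f :: "nat \<Rightarrow> int"
    show "\<forall>\<^sub>F p in cofinite. prime p \<longrightarrow>
        [residue p (r + s) * f p = residue p r * f p + residue p s * f p] (mod int p)"
      using residue_add[of r s]
      by eventually_elim (auto simp flip: distrib_right intro: cong_mult)
  qed
  show "adele_scale r (adele_scale s x) = adele_scale (r * s) x"
  proof (transfer, unfold almost_cong_def)
    fix r s and f :: "nat \<Rightarrow> int"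
    show "\<forall>\<^sub>F p in cofinite. prime p \<longrightarrow>
        [residue p r * (residue p s * f p) = residue p (r * s) * f p] (mod int p)"
      using residue_mult[of r s]
      by eventually_elim (auto simp flip: mult.assoc intro: cong_mult cong_sym)
  qed
  show "adele_scale 1 x = x"
    by transfer (simp add: almost_cong_def residue_1)
qed

lemma adele_scale_mult: "adele_scale r (x * y) = adele_scale r x * y"
  by transfer (simp add: almost_cong_def mult.assoc)


section \<open>Finite alternating multiple mixed values\<close>

definition mixed_indices :: "nat \<Rightarrow> int list \<Rightarrow> nat list set" where
  "mixed_indices p \<epsilon> = {k. length k = length \<epsilon> \<and> sorted_wrt (>) k \<and> set k \<subseteq> {0<..<p} \<and>
     (\<forall>j<length \<epsilon>. (\<epsilon> ! j = 1 \<longrightarrow> even (k ! j)) \<and> (\<epsilon> ! j = -1 \<longrightarrow> odd (k ! j)))}"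

text \<open>
  The division by 4 in the exponent is exact because of the parity of \<open>k ! j\<close>. All \<open>k ! j\<close> are less
  than \<open>p\<close>, so \<open>p\<close> does not divide the denominator of this sum.
\<close>
definition mixed_sum :: "nat \<Rightarrow> nat list \<Rightarrow> int list \<Rightarrow> int list \<Rightarrow> rat" where
  "mixed_sum p s \<epsilon> \<sigma> = (\<Sum>k\<in>mixed_indices p \<epsilon>. \<Prod>j<length s.
     of_int (\<sigma> ! j) ^ nat ((2 * int (k ! j) + 1 - \<epsilon> ! j) div 4) / of_nat (k ! j) ^ (s ! j))"

definition M\<^sub>A :: "nat list \<Rightarrow> int list \<Rightarrow> int list \<Rightarrow> adele" where
  "M\<^sub>A s \<epsilon> \<sigma> = adele_of (\<lambda>p. residue p (mixed_sum p s \<epsilon> \<sigma>))"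

definition FAMMV :: "nat \<Rightarrow> adele set" where
  "FAMMV w = adele.span {M\<^sub>A s \<epsilon> \<sigma> | s \<epsilon> \<sigma>.
     length \<epsilon> = length s \<and> length \<sigma> = length s \<and>
     set s \<subseteq> {0<..} \<and> set \<epsilon> \<subseteq> {1, -1} \<and> set \<sigma> \<subseteq> {1, -1} \<and> sum_list s = w}"


section \<open>The generators in weight 2\<close>

text \<open>The division by \<open>p\<close> is exact for every odd prime \<open>p\<close>.\<close>
definition q\<^sub>2 :: adele where
  "q\<^sub>2 = adele_of (\<lambda>p. (2 ^ (p - 1) - 1) div int p)"

definition euler_number :: "nat \<Rightarrow> rat" where
  "euler_number n = fact n * fps_nth (2 / (fps_exp 1 + fps_exp (-1))) n"

text \<open>Euler numbers are integers, so \<^term>\<open>euler_number n / 2\<close> is \<open>p\<close>-integral for every odd \<open>p\<close>.\<close>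
definition G\<^sub>A :: adele where
  "G\<^sub>A = adele_of (\<lambda>p. residue p (euler_number (p - 3) / 2))"

definition sign_A :: adele where
  "sign_A = adele_of (\<lambda>p. (-1) ^ ((p - 1) div 2))"

end

theory Submission
  imports Defs "HOL-Number_Theory.Residues"
begin

text \<open>
  The reflection \<open>k \<mapsto> p - k\<close> exchanges even and odd summation indices, so up to the factors
  \<open>\<plusminus>1\<close> and \<open>\<plusminus>sign_A\<close> every value of weight 2 reduces to sums over even indices. For a double sum
  over an even and an odd index one expands into partial fractions on the complementary region,
  and the product of the two single sums is left over. The single sums over even indices are
  \<open>-q\<^sub>2\<close> and \<open>-q\<^sub>2/2\<close> in weight 1, from the even part of the expansion of \<open>(1 + x)\<^sup>p\<close> at \<open>x = 1\<close> and
  \<open>x = \<i>\<close>, and \<open>0\<close> and \<open>sign_A * G\<^sub>A\<close> in weight 2, the latter from the telescoping of Euler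
  polynomials. Up to stuffle products only one double sum over even indices remains, the sum of
  \<open>(-1)\<^sup>j / (i * j)\<close> over \<open>p/2 > i > j > 0\<close>; it is found by splitting the double sum over even
  \<open>k\<close> and odd \<open>l < k\<close> at \<open>p/2\<close>.
\<close>

section \<open>Finite single and double sums\<close>

definition dsum :: "nat \<Rightarrow> (nat \<Rightarrow> int) \<Rightarrow> (nat \<Rightarrow> int) \<Rightarrow> int" where
  "dsum n f g = (\<Sum>k=1..n. f k * (\<Sum>l=1..<k. g l))"

lemma dsum_0 [simp]: "dsum 0 f g = 0"
  by (simp add: dsum_def)

lemma dsum_Suc: "dsum (Suc n) f g = dsum n f g + f (Suc n) * (\<Sum>l=1..n. g l)"
  by (simp add: dsum_def atLeastLessThanSuc_atLeastAtMost)

text \<open>The square of index pairs consists of two open triangles and the diagonal.\<close>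

lemma dsum_stuffle:
  "dsum n f g + dsum n g f + (\<Sum>k=1..n. f k * g k) = (\<Sum>k=1..n. f k) * (\<Sum>k=1..n. g k)"
  by (induction n) (simp_all add: dsum_Suc algebra_simps)

text \<open>Sending \<open>k\<close> to \<open>n + 1 - k\<close> inverts the order of the two
  indices, so \<open>f\<close> and \<open>g\<close> change places.\<close>

lemma dsum_rev: "dsum n f g = dsum n (\<lambda>k. g (Suc n - k)) (\<lambda>k. f (Suc n - k))"
proof -
  have "dsum n f g = (\<Sum>(k, l)\<in>(SIGMA k:{1..n}. {1..<k}). f k * g l)"
    by (simp add: dsum_def sum_distrib_left sum.Sigma)
  also have "\<dots> = (\<Sum>(k, l)\<in>(SIGMA k:{1..n}. {1..<k}). g (Suc n - k) * f (Suc n - l))"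
    by (rule sum.reindex_bij_witness[where i = "\<lambda>(k, l). (Suc n - l, Suc n - k)"
          and j = "\<lambda>(k, l). (Suc n - l, Suc n - k)"]) auto
  also have "\<dots> = dsum n (\<lambda>k. g (Suc n - k)) (\<lambda>k. f (Suc n - k))"
    by (simp add: dsum_def sum_distrib_left sum.Sigma)
  finally show ?thesis .
qed

lemma sum_rev: "(\<Sum>k=1..n. f k) = (\<Sum>k=1..n. f (Suc n - k))" for f :: "nat \<Rightarrow> 'a::comm_monoid_add"
  by (rule sum.reindex_bij_witness[where i = "\<lambda>k. Suc n - k" and j = "\<lambda>k. Suc n - k"]) auto

lemma dsum_cong:
  assumes "\<And>k. k \<in> {1..n} \<Longrightarrow> [f k = f' k] (mod m)" "\<And>k. k \<in> {1..n} \<Longrightarrow> [g k = g' k] (mod m)"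
  shows "[dsum n f g = dsum n f' g'] (mod m)"
  unfolding dsum_def by (intro cong_sum cong_mult assms) auto

text \<open>The two indices lie both below, both above, or on different sides of the cut at
  \<open>m\<close>; in the last case they are independent and give a product.\<close>

lemma dsum_split:
  "dsum (m + n) f g = dsum m f g + (\<Sum>k=1..n. f (m + k)) * (\<Sum>l=1..m. g l)
     + dsum n (\<lambda>k. f (m + k)) (\<lambda>k. g (m + k))"
proof (induction n)
  case (Suc n)
  have "(\<Sum>l=1..m + n. g l) = (\<Sum>l=1..m. g l) + (\<Sum>l=1..n. g (m + l))"
    by (induction n) (simp_all add: algebra_simps)
  thus ?case using Suc by (simp add: dsum_Suc algebra_simps)
qed simp

lemma dsum_mult: "dsum n (\<lambda>k. a * f k) (\<lambda>k. b * g k) = a * b * dsum n f g"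
  by (simp add: dsum_def sum_distrib_left mult_ac)

lemma dsum_add_right: "dsum n f (\<lambda>k. g k + g' k) = dsum n f g + dsum n f g'"
  by (simp add: dsum_def sum.distrib algebra_simps)

lemma dsum_add_left: "dsum n (\<lambda>k. f k + f' k) g = dsum n f g + dsum n f' g"
  by (simp add: dsum_def sum.distrib algebra_simps)

section \<open>Sums over indices of prescribed parity\<close>

lemma sum_even_indices:
  fixes f :: "nat \<Rightarrow> 'a::comm_monoid_add"
  assumes "\<And>k. odd k \<Longrightarrow> f k = 0"
  shows "(\<Sum>k=Suc 0..2*h. f k) = (\<Sum>j=Suc 0..h. f (2 * j))"
  by (induction h) (simp_all add: assms)

lemma dsum_even_indices:
  assumes "\<And>k. odd k \<Longrightarrow> f k = 0" "\<And>k. odd k \<Longrightarrow> g k = 0"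
  shows "dsum (2 * h) f g = dsum h (\<lambda>j. f (2 * j)) (\<lambda>j. g (2 * j))"
proof (induction h)
  case (Suc h)
  have "dsum (2 * Suc h) f g = dsum (2 * h) f g + f (2 * Suc h) * (\<Sum>l=1..2*h. g l)"
    by (simp add: dsum_Suc assms)
  thus ?case
    using Suc sum_even_indices[of g h, OF assms(2)] by (simp add: dsum_Suc)
qed simp

text \<open>An odd index is written as \<open>Suc (2 * h) - 2 * j\<close>, the mirror image of an
  even one; it is less than \<open>2 * i\<close> exactly when \<open>j > h - i\<close>.\<close>

lemma sum_odd_indices_less:
  fixes g :: "nat \<Rightarrow> 'a::comm_monoid_add"
  assumes "\<And>k. even k \<Longrightarrow> g k = 0" "i \<le> h"
  shows "(\<Sum>l=1..<2*i. g l) = (\<Sum>j=Suc (h - i)..h. g (Suc (2 * h) - 2 * j))"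
  using assms(2)
proof (induction i)
  case (Suc i)
  have "(\<Sum>l=1..<2 * Suc i. g l) = (\<Sum>l=1..<2*i. g l) + g (2 * i + 1)"
  \<comment> \<open>For \<open>i = 0\<close> the even index \<open>2 * i\<close> lies outside the
    range, which starts at 1.\<close>
  proof (cases "i = 0")
    case True
    moreover have "{1..<2} = {1::nat}" by auto
    ultimately show ?thesis by simp
  next
    case False
    hence "{1..<2 * Suc i} = insert (2 * i + 1) (insert (2 * i) {1..<2*i})" by auto
    thus ?thesis by (simp add: assms(1) add.commute)
  qed
  also have "\<dots> = (\<Sum>j=h - i..h. g (Suc (2 * h) - 2 * j))"
  proof -
    have "{h - i..h} = insert (h - i) {Suc (h - i)..h}" using Suc.prems by auto
    moreover have "Suc (2 * h) - 2 * (h - i) = 2 * i + 1" using Suc.prems by auto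
    ultimately show ?thesis using Suc by (simp add: add.commute)
  qed
  finally show ?case using Suc.prems by (simp add: Suc_diff_Suc)
qed simp

text \<open>The triangle \<open>i + j \<le> h\<close>, complementary to the condition on the
  indices, is subtracted from the full square.\<close>

lemma dsum_even_odd_indices:
  assumes "\<And>k. odd k \<Longrightarrow> f k = 0" "\<And>k. even k \<Longrightarrow> g k = 0"
  shows "dsum (2 * h) f g
    = (\<Sum>i=1..h. f (2 * i)) * (\<Sum>j=1..h. g (Suc (2 * h) - 2 * j))
      - (\<Sum>i=1..h. \<Sum>j=1..h - i. f (2 * i) * g (Suc (2 * h) - 2 * j))"
proof -
  let ?g = "\<lambda>j. g (Suc (2 * h) - 2 * j)"
  have "dsum (2 * h) f g = (\<Sum>i=1..h. f (2 * i) * (\<Sum>l=1..<2*i. g l))"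
    unfolding dsum_def One_nat_def by (rule sum_even_indices) (simp add: assms)
  also have "\<dots> = (\<Sum>i=1..h. f (2 * i) * ((\<Sum>j=1..h. ?g j) - (\<Sum>j=1..h - i. ?g j)))"
  proof (rule sum.cong[OF refl])
    fix i assume "i \<in> {1..h}"
    hence "{1..h} = {1..h - i} \<union> {Suc (h - i)..h}" "{1..h - i} \<inter> {Suc (h - i)..h} = {}" by auto
    hence "(\<Sum>j=1..h. ?g j) = (\<Sum>j=1..h - i. ?g j) + (\<Sum>j=Suc (h - i)..h. ?g j)"
      by (simp add: sum.union_disjoint)
    thus "f (2 * i) * (\<Sum>l=1..<2*i. g l)
        = f (2 * i) * ((\<Sum>j=1..h. ?g j) - (\<Sum>j=1..h - i. ?g j))"
      using sum_odd_indices_less[of g i h, OF assms(2)] \<open>i \<in> {1..h}\<close> by simp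
  qed
  finally show ?thesis
    by (simp add: right_diff_distrib sum_subtractf sum_distrib_left flip: sum_product)
qed

text \<open>Sorting by \<open>n = i + j\<close> prepares for partial fractions, where
  \<open>i + j\<close> becomes a denominator and hence the outer index.\<close>

lemma sum_triangle:
  fixes F :: "nat \<Rightarrow> nat \<Rightarrow> 'a::comm_monoid_add"
  shows "(\<Sum>i=1..h. \<Sum>j=1..h - i. F i j) = (\<Sum>n=1..h. \<Sum>i=1..<n. F i (n - i))"
proof -
  have "(\<Sum>i=1..h. \<Sum>j=1..h - i. F i j) = (\<Sum>(i, j)\<in>(SIGMA i:{1..h}. {1..h - i}). F i j)"
    by (simp add: sum.Sigma)
  also have "\<dots> = (\<Sum>(n, i)\<in>(SIGMA n:{1..h}. {1..<n}). F i (n - i))"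
    by (rule sum.reindex_bij_witness[where i = "\<lambda>(n, i). (i, n - i)" and j = "\<lambda>(i, j). (i + j, i)"])
      auto
  finally show ?thesis by (simp add: sum.Sigma)
qed

section \<open>Euler numbers\<close>

definition euler_egf :: "rat fps" where
  "euler_egf = 2 / (fps_exp 1 + fps_exp (-1))"

lemma euler_egf_mult: "euler_egf * (fps_exp 1 + fps_exp (-1)) = 2"
proof -
  have "fps_nth (fps_exp 1 + fps_exp (-1) :: rat fps) 0 \<noteq> 0" by simp
  hence "(fps_exp 1 + fps_exp (-1) :: rat fps) dvd 2"
    by (intro unit_imp_dvd[OF iffD2[OF fps_is_unit_iff]])
  thus ?thesis by (simp add: euler_egf_def)
qed

lemma euler_number_egf: "euler_number n = fact n * fps_nth euler_egf n"
  by (simp add: euler_number_def euler_egf_def)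

text \<open>Since n! = C(n, k) k! (n - k)!, products of exponential generating functions turn into
  binomial convolutions.\<close>

lemma fact_mult_fps_mult_nth:
  fixes f g :: "rat fps"
  shows "fact n * fps_nth (f * g) n
    = (\<Sum>k\<le>n. of_nat (n choose k) * (fact k * fps_nth f k) * (fact (n - k) * fps_nth g (n - k)))"
proof -
  have "fact n = of_nat (n choose k) * fact k * (fact (n - k) :: rat)" if "k \<le> n" for k
    using that by (simp add: binomial_fact)
  thus ?thesis
    by (simp add: fps_mult_nth sum_distrib_left atMost_atLeast0 mult_ac cong: sum.cong_simp)
qed

lemma euler_number_recurrence:
  "(\<Sum>k\<le>n. of_nat (n choose k) * euler_number k * (1 + (-1) ^ (n - k))) = (if n = 0 then 2 else 0)"
proof -
  have "(\<Sum>k\<le>n. of_nat (n choose k) * euler_number k * (1 + (-1) ^ (n - k)))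
      = fact n * fps_nth (euler_egf * (fps_exp 1 + fps_exp (-1))) n"
    unfolding fact_mult_fps_mult_nth
    by (intro sum.cong) (simp_all add: euler_number_egf distrib_left)
  thus ?thesis by (simp add: euler_egf_mult numeral_fps_const)
qed

text \<open>In the recurrence the factor \<open>1 + (-1) ^ (n - k)\<close> is 0 or 2, so halving
  leaves integer coefficients in front of the earlier Euler numbers.\<close>

lemma euler_number_Ints: "euler_number n \<in> \<int>"
proof (induction n rule: less_induct)
  case (less n)
  let ?t = "\<lambda>k. of_nat (n choose k) * euler_number k * (1 + (-1) ^ (n - k))"
  have eq: "2 * euler_number n = (if n = 0 then 2 else 0) - (\<Sum>k<n. ?t k)"
    using euler_number_recurrence[of n] by (simp add: lessThan_Suc_atMost[symmetric])
  have "(\<Sum>k<n. ?t k)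
      = 2 * (\<Sum>k<n. of_nat (n choose k) * euler_number k * (if even (n - k) then 1 else 0))"
    unfolding sum_distrib_left by (rule sum.cong) auto
  hence "euler_number n = (if n = 0 then 1 else 0)
      - (\<Sum>k<n. of_nat (n choose k) * euler_number k * (if even (n - k) then 1 else 0))"
    using eq by (simp split: if_splits)
  also have "\<dots> \<in> \<int>" by (intro Ints_diff Ints_sum Ints_mult less) auto
  finally show ?case .
qed

section \<open>Euler polynomials and alternating power sums\<close>

definition euler_int :: "nat \<Rightarrow> int" where
  "euler_int n = \<lfloor>euler_number n\<rfloor>"

lemma of_int_euler_int [simp]: "of_int (euler_int n) = euler_number n"
  using euler_number_Ints[of n] by (auto simp: euler_int_def elim: Ints_cases)

text \<open>This is 2^n times the classical n-th Euler polynomial at (x + 1)/2.\<close>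

definition euler_poly :: "nat \<Rightarrow> int \<Rightarrow> int" where
  "euler_poly n x = (\<Sum>k\<le>n. int (n choose k) * euler_int k * x ^ (n - k))"

lemma euler_poly_egf:
  "of_int (euler_poly n x) = fact n * fps_nth (euler_egf * fps_exp (of_int x)) n"
  by (simp add: euler_poly_def fact_mult_fps_mult_nth euler_number_egf)

text \<open>Multiplying the generating function by e^t + e^(-t) cancels its denominator and leaves 2
  e^(xt). The arguments are two apart, so the relation telescopes over even
  \<open>x\<close>.\<close>

lemma euler_poly_step: "euler_poly n (x + 1) + euler_poly n (x - 1) = 2 * x ^ n"
proof -
  have "euler_egf * fps_exp (of_int (x + 1)) + euler_egf * fps_exp (of_int (x - 1))
      = euler_egf * (fps_exp 1 + fps_exp (-1)) * fps_exp (of_int x)"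
    using fps_exp_add_mult[of "of_int x :: rat" 1] fps_exp_add_mult[of "of_int x :: rat" "-1"]
    by (simp add: algebra_simps)
  also have "\<dots> = 2 * fps_exp (of_int x)" by (simp add: euler_egf_mult)
  finally have "(of_int (euler_poly n (x + 1)) + of_int (euler_poly n (x - 1)) :: rat)
      = fact n * fps_nth (2 * fps_exp (of_int x)) n"
    by (simp add: euler_poly_egf flip: distrib_left fps_add_nth)
  hence "(of_int (euler_poly n (x + 1) + euler_poly n (x - 1)) :: rat) = of_int (2 * x ^ n)"
    by (simp add: numeral_fps_const)
  thus ?thesis by (simp only: of_int_eq_iff)
qed

text \<open>Only the term \<open>k = n\<close> is free of \<open>x\<close>. The congruence is
  applied at p and -p.\<close>

lemma euler_poly_cong: "[euler_poly n x = euler_int n] (mod x)"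
proof -
  have "euler_poly n x = (\<Sum>k<n. int (n choose k) * euler_int k * x ^ (n - k)) + euler_int n"
    by (simp add: euler_poly_def flip: lessThan_Suc_atMost)
  moreover have "x dvd (\<Sum>k<n. int (n choose k) * euler_int k * x ^ (n - k))"
    by (intro dvd_sum dvd_mult) (simp add: dvd_power)
  ultimately show ?thesis by (simp add: cong_iff_dvd_diff)
qed

text \<open>Put T(j) = P(2j + 1) + P(-(2j + 1)) with P the polynomial \<open>euler_poly n\<close>.
  Adding the step relations at 2j and -2j gives T(j) + T(j - 1) = 4 (2j)^n, so the alternating sum
  telescopes.\<close>

lemma alternating_power_sum:
  assumes "even n" "n > 0"
  shows "4 * (\<Sum>j=1..h. (-1) ^ j * (2 * int j) ^ n)
    = (-1) ^ h * (euler_poly n (2 * int h + 1) + euler_poly n (- (2 * int h + 1)))"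
proof (induction h)
  case 0
  \<comment> \<open>The boundary value is twice \<open>0 ^ n\<close>, which vanishes since
    \<open>n > 0\<close>.\<close>
  show ?case using euler_poly_step[of n 0] assms by simp
next
  case (Suc h)
  let ?y = "2 * int (Suc h)"
  have "euler_poly n (2 * int h + 3) + euler_poly n (2 * int h + 1) = 2 * ?y ^ n"
    using euler_poly_step[of n ?y] by (simp add: algebra_simps)
  moreover have "euler_poly n (- (2 * int h + 1)) + euler_poly n (- (2 * int h + 3)) = 2 * ?y ^ n"
  proof -
    have "- ?y + 1 = - (2 * int h + 1)" "- ?y - 1 = - (2 * int h + 3)" by simp_all
    moreover have "(- ?y) ^ n = ?y ^ n" using assms by (simp only: power_minus_even)
    ultimately show ?thesis using euler_poly_step[of n "- ?y"] by (simp only:)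
  qed
  ultimately have "euler_poly n (2 * int h + 3) + euler_poly n (- (2 * int h + 3))
      = 4 * ?y ^ n - (euler_poly n (2 * int h + 1) + euler_poly n (- (2 * int h + 1)))"
    by linarith
  moreover have "4 * (\<Sum>j=1..Suc h. (-1) ^ j * (2 * int j) ^ n)
      = (-1) ^ Suc h * (4 * ?y ^ n - (euler_poly n (2 * int h + 1) + euler_poly n (- (2 * int h + 1))))"
    using Suc by (simp add: algebra_simps del: of_nat_Suc)
  moreover have "2 * int (Suc h) + 1 = 2 * int h + 3" by simp
  ultimately show ?case by (simp only:)
qed

section \<open>Congruences modulo a prime\<close>

text \<open>An inverse modulo the prime \<open>p\<close>, chosen as a power so as to be multiplicative in \<open>k\<close>.\<close>
definition pinv :: "nat \<Rightarrow> nat \<Rightarrow> int" where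
  "pinv p k = int k ^ (p - 2)"

lemma pinv_mult: "pinv p (a * b) = pinv p a * pinv p b"
  by (simp add: pinv_def power_mult_distrib)

text \<open>The numerator of a summand, set to 0 at indices of the wrong parity, so that parity
  conditions need not be carried by the ranges of summation.\<close>

definition mixed_sign :: "int \<Rightarrow> int \<Rightarrow> nat \<Rightarrow> int" where
  "mixed_sign \<epsilon> \<alpha> k = (if \<epsilon> = 1 \<and> even k \<or> \<epsilon> = -1 \<and> odd k
     then \<alpha> ^ nat ((2 * int k + 1 - \<epsilon>) div 4) else 0)"

lemma mixed_sign_even: "mixed_sign 1 \<alpha> k = (if even k then \<alpha> ^ (k div 2) else 0)"
proof -
  have "2 * int k div 4 = int (k div 2)" by presburger
  thus ?thesis by (simp add: mixed_sign_def)
qed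

lemma mixed_sign_odd: "mixed_sign (-1) \<alpha> k = (if odd k then \<alpha> ^ ((k + 1) div 2) else 0)"
proof -
  have "(2 + 2 * int k) div 4 = int ((k + 1) div 2)" by presburger
  hence "nat ((2 + 2 * int k) div 4) = (k + 1) div 2" by (simp only: nat_int)
  thus ?thesis by (simp add: mixed_sign_def)
qed

lemma mixed_sign_mult:
  "mixed_sign \<epsilon> \<alpha> k * mixed_sign \<epsilon> \<beta> k = mixed_sign \<epsilon> (\<alpha> * \<beta>) k"
  by (simp add: mixed_sign_def power_mult_distrib)

definition mixed_term :: "nat \<Rightarrow> int \<Rightarrow> int \<Rightarrow> nat \<Rightarrow> int" where
  "mixed_term p \<epsilon> \<alpha> k = mixed_sign \<epsilon> \<alpha> k * pinv p k"

lemma mixed_term_even [simp]: "mixed_term p 1 \<alpha> (2 * j) = \<alpha> ^ j * pinv p (2 * j)"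
  by (simp add: mixed_term_def mixed_sign_even)

lemma mixed_term_eq_0 [simp]:
  "odd k \<Longrightarrow> mixed_term p 1 \<alpha> k = 0" "even k \<Longrightarrow> mixed_term p (-1) \<alpha> k = 0"
  by (simp_all add: mixed_term_def mixed_sign_even mixed_sign_odd)

text \<open>The sign relating the summands at \<open>k\<close> and at \<open>p - k\<close>, where \<open>p = 2 * h + 1\<close>.\<close>
definition reflection_sign :: "int \<Rightarrow> nat \<Rightarrow> int" where
  "reflection_sign \<alpha> h = - (\<alpha> ^ Suc h)"

lemma reflection_sign_simps [simp]:
  "reflection_sign 1 h = -1" "reflection_sign (-1) h = (-1) ^ h"
  by (simp_all add: reflection_sign_def)

text \<open>The bound on \<open>h\<close> means p \<ge> 5: it makes \<open>p - 3\<close> positive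
  and 2 and 4 invertible, and excludes only the primes 2 and 3.\<close>

locale large_prime =
  fixes p h :: nat
  assumes prime: "prime p" and p_eq: "p = Suc (2 * h)" and h_ge: "h \<ge> 2"
begin

lemma cong_cancel:
  assumes "\<not> int p dvd c" "[c * x = c * y] (mod int p)"
  shows "[x = y] (mod int p)"
  using residue_cancel[OF prime assms(1)] assms(2) by (simp add: mult.commute)

lemma not_dvd: "k \<in> {1..2*h} \<Longrightarrow> \<not> int p dvd int k"
  using p_eq unfolding of_nat_dvd_iff by (auto dest!: dvd_imp_le)

section \<open>Inverses modulo p\<close>

lemma pinv_inverse:
  assumes "k \<in> {1..2*h}"
  shows "[int k * pinv p k = 1] (mod int p)"
proof -
  have "[k ^ (p - 1) = 1] (mod p)"
    using fermat_theorem[OF prime, of k] not_dvd[OF assms] by simp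
  hence "[int k ^ (p - 1) = 1] (mod int p)"
    by (metis cong_int_iff of_nat_1 of_nat_power)
  moreover have "p - 1 = Suc (p - 2)" using p_eq h_ge by simp
  ultimately show ?thesis by (simp add: pinv_def)
qed

lemma pinv_unique:
  assumes "k \<in> {1..2*h}" "[int k * c = 1] (mod int p)"
  shows "[c = pinv p k] (mod int p)"
  by (rule cong_cancel[OF not_dvd[OF assms(1)]])
    (use assms pinv_inverse[OF assms(1)] cong_sym cong_trans in blast)

lemma two_pinv_two: "[2 * pinv p 2 = 1] (mod int p)"
  using pinv_inverse[of 2] h_ge by simp

text \<open>\<open>p - k\<close> is congruent to \<open>- k\<close>, and the exponent
  \<open>p - 2\<close> is odd.\<close>

lemma pinv_reflect:
  assumes "k \<le> p"
  shows "[pinv p (p - k) = - pinv p k] (mod int p)"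
proof -
  have "odd (p - 2)" using p_eq h_ge by simp
  have "[int (p - k) ^ (p - 2) = (- int k) ^ (p - 2)] (mod int p)"
    using assms by (intro cong_pow) (simp add: of_nat_diff cong_iff_dvd_diff)
  thus ?thesis using \<open>odd (p - 2)\<close> by (simp add: pinv_def)
qed

lemma pinv_partial_fraction:
  assumes "a \<in> {1..2*h}" "b \<in> {1..2*h}" "a + b \<in> {1..2*h}"
  shows "[pinv p a * pinv p b = pinv p (a + b) * (pinv p a + pinv p b)] (mod int p)"
proof -
  let ?x = "pinv p a" and ?y = "pinv p b" and ?z = "pinv p (a + b)"
  have d: "int p dvd int a * ?x - 1" "int p dvd int b * ?y - 1" "int p dvd int (a + b) * ?z - 1"
    using assms by (simp_all only: pinv_inverse flip: cong_iff_dvd_diff)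
  \<comment> \<open>The difference is an explicit combination of the three defects in
    \<open>d\<close>, each divisible by p.\<close>
  have "?x * ?y - ?z * (?x + ?y) = - (?x * ?y * (int (a + b) * ?z - 1))
      + ?z * (?y * (int a * ?x - 1) + ?x * (int b * ?y - 1))"
    by (simp add: algebra_simps)
  also have "int p dvd \<dots>"
    using d by (intro dvd_add dvd_mult) (simp_all only: dvd_minus_iff dvd_mult)
  finally show ?thesis by (simp add: cong_iff_dvd_diff)
qed

section \<open>Reflection of k to p - k\<close>

lemma mixed_sign_reflect:
  assumes "\<alpha> \<in> {1, -1}" "k \<in> {1..2*h}"
  shows "mixed_sign (-1) \<alpha> (p - k) = - reflection_sign \<alpha> h * mixed_sign 1 \<alpha> k"
    and "mixed_sign 1 \<alpha> (p - k) = - reflection_sign \<alpha> h * mixed_sign (-1) \<alpha> k"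
proof -
  \<comment> \<open>As \<alpha> is its own inverse, the power with a difference in the exponent
    becomes a product.\<close>
  have pow: "\<alpha> ^ (Suc h - j) = \<alpha> ^ Suc h * \<alpha> ^ j" if "j \<le> Suc h" for j
  proof -
    have "\<alpha> ^ Suc h = \<alpha> ^ (Suc h - j) * \<alpha> ^ j" using that by (simp flip: power_add)
    moreover have "\<alpha> ^ j * \<alpha> ^ j = 1" using assms(1) by (auto simp flip: power_mult_distrib)
    ultimately show ?thesis by (simp add: mult.assoc)
  qed
  \<comment> \<open>The exponents of \<alpha> at the two mirror images add up to
    \<open>Suc h\<close>; this is where the reflection sign comes from.\<close>
  have "(p - k + 1) div 2 = Suc h - k div 2" "k div 2 \<le> Suc h" if "even k"
    using that assms(2) p_eq by (auto elim!: evenE)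
  thus "mixed_sign (-1) \<alpha> (p - k) = - reflection_sign \<alpha> h * mixed_sign 1 \<alpha> k"
    using assms(2) p_eq pow[of "k div 2"]
    by (auto simp: mixed_sign_even mixed_sign_odd reflection_sign_def simp del: power_Suc)
  have "(p - k) div 2 = Suc h - (k + 1) div 2" "(k + 1) div 2 \<le> Suc h" if "odd k"
    using that assms(2) p_eq by (auto elim!: oddE)
  thus "mixed_sign 1 \<alpha> (p - k) = - reflection_sign \<alpha> h * mixed_sign (-1) \<alpha> k"
    using assms(2) p_eq pow[of "(k + 1) div 2"]
    by (auto simp: mixed_sign_even mixed_sign_odd reflection_sign_def simp del: power_Suc)
qed

text \<open>The numerator contributes \<open>- reflection_sign \<alpha> h\<close>, and the inverse
  of \<open>p - k\<close> contributes another -1.\<close>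

lemma mixed_term_reflect:
  assumes "\<alpha> \<in> {1, -1}" "k \<in> {1..2*h}"
  shows "[mixed_term p (-1) \<alpha> (p - k) = reflection_sign \<alpha> h * mixed_term p 1 \<alpha> k] (mod int p)"
    and "[mixed_term p 1 \<alpha> (p - k) = reflection_sign \<alpha> h * mixed_term p (-1) \<alpha> k] (mod int p)"
proof -
  have "[c * pinv p (p - k) = c * - pinv p k] (mod int p)" for c
    using assms(2) p_eq by (intro cong_mult cong_refl pinv_reflect) auto
  from this[of "- reflection_sign \<alpha> h * mixed_sign 1 \<alpha> k"]
    this[of "- reflection_sign \<alpha> h * mixed_sign (-1) \<alpha> k"]
  show "[mixed_term p (-1) \<alpha> (p - k) = reflection_sign \<alpha> h * mixed_term p 1 \<alpha> k] (mod int p)"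
    and "[mixed_term p 1 \<alpha> (p - k) = reflection_sign \<alpha> h * mixed_term p (-1) \<alpha> k] (mod int p)"
    by (simp_all add: mixed_term_def mixed_sign_reflect[OF assms] mult.assoc)
qed

lemma sum_odd_reflect:
  assumes "\<alpha> \<in> {1, -1}"
  shows "[(\<Sum>k=1..2*h. mixed_term p (-1) \<alpha> k)
    = reflection_sign \<alpha> h * (\<Sum>k=1..2*h. mixed_term p 1 \<alpha> k)] (mod int p)"
  unfolding sum_distrib_left sum_rev[of "mixed_term p (-1) \<alpha>"]
  by (intro cong_sum) (use mixed_term_reflect(1)[OF assms] p_eq in simp)

text \<open>The sign of the inverse disappears on squaring, hence the additional minus compared with
  weight 1.\<close>

lemma sum_squares_odd_reflect:
  assumes "\<alpha> \<in> {1, -1}"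
  shows "[(\<Sum>k=1..2*h. mixed_sign (-1) \<alpha> k * pinv p k ^ 2)
    = - reflection_sign \<alpha> h * (\<Sum>k=1..2*h. mixed_sign 1 \<alpha> k * pinv p k ^ 2)] (mod int p)"
  unfolding sum_distrib_left sum_rev[of "\<lambda>k. mixed_sign (-1) \<alpha> k * pinv p k ^ 2"]
proof (rule cong_sum)
  fix k assume k: "k \<in> {1..2*h}"
  have "[pinv p (p - k) ^ 2 = (- pinv p k) ^ 2] (mod int p)"
    using k p_eq by (intro cong_pow pinv_reflect) auto
  hence "[mixed_sign (-1) \<alpha> (p - k) * pinv p (p - k) ^ 2
      = mixed_sign (-1) \<alpha> (p - k) * pinv p k ^ 2] (mod int p)"
    by (intro cong_mult cong_refl) simp
  thus "[mixed_sign (-1) \<alpha> (Suc (2 * h) - k) * pinv p (Suc (2 * h) - k) ^ 2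
      = - reflection_sign \<alpha> h * (mixed_sign 1 \<alpha> k * pinv p k ^ 2)] (mod int p)"
    unfolding mixed_sign_reflect(1)[OF assms k] p_eq[symmetric] by (simp only: mult.assoc)
qed

text \<open>Reflecting both indices also reverses their order, so \<alpha> and \<beta> change
  places.\<close>

lemma dsum_odd_odd_reflect:
  assumes "\<alpha> \<in> {1, -1}" "\<beta> \<in> {1, -1}"
  shows "[dsum (2 * h) (mixed_term p (-1) \<alpha>) (mixed_term p (-1) \<beta>)
    = reflection_sign \<alpha> h * reflection_sign \<beta> h
      * dsum (2 * h) (mixed_term p 1 \<beta>) (mixed_term p 1 \<alpha>)] (mod int p)"
proof -
  have "dsum (2 * h) (mixed_term p (-1) \<alpha>) (mixed_term p (-1) \<beta>)
      = dsum (2 * h) (\<lambda>k. mixed_term p (-1) \<beta> (p - k)) (\<lambda>k. mixed_term p (-1) \<alpha> (p - k))"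
    using p_eq by (subst dsum_rev) simp
  also have "[\<dots> = dsum (2 * h) (\<lambda>k. reflection_sign \<beta> h * mixed_term p 1 \<beta> k)
      (\<lambda>k. reflection_sign \<alpha> h * mixed_term p 1 \<alpha> k)] (mod int p)"
    by (intro dsum_cong mixed_term_reflect assms)
  also have "dsum (2 * h) (\<lambda>k. reflection_sign \<beta> h * mixed_term p 1 \<beta> k)
      (\<lambda>k. reflection_sign \<alpha> h * mixed_term p 1 \<alpha> k)
    = reflection_sign \<alpha> h * reflection_sign \<beta> h
      * dsum (2 * h) (mixed_term p 1 \<beta>) (mixed_term p 1 \<alpha>)"
    unfolding dsum_mult by (simp only: mult.commute[of "reflection_sign \<beta> h"])
  finally show ?thesis .
qed

text \<open>
  Substituting \<open>k = 2 * i\<close> and \<open>l = p - 2 * j\<close>, the condition \<open>l < k\<close> becomes \<open>i + j > h\<close>; on the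
  complement \<open>i + j \<le> h\<close> the partial fraction expansion of \<open>1 / (i * j)\<close> gives double sums over
  even indices.
\<close>
lemma dsum_even_odd:
  assumes \<alpha>: "\<alpha> \<in> {1, -1}" and \<beta>: "\<beta> \<in> {1, -1}"
  shows "[dsum (2 * h) (mixed_term p 1 \<alpha>) (mixed_term p (-1) \<beta>)
    = reflection_sign \<beta> h
      * ((\<Sum>k=1..2*h. mixed_term p 1 \<alpha> k) * (\<Sum>k=1..2*h. mixed_term p 1 \<beta> k)
        - dsum (2 * h) (mixed_term p 1 \<beta>) (mixed_term p 1 (\<alpha> * \<beta>))
        - dsum (2 * h) (mixed_term p 1 \<alpha>) (mixed_term p 1 (\<alpha> * \<beta>)))] (mod int p)"
proof -
  define c where "c = reflection_sign \<beta> h"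
  define v where "v = (\<lambda>j. pinv p (2 * j))"
  have reflect: "[mixed_term p (-1) \<beta> (Suc (2 * h) - 2 * j) = c * (\<beta> ^ j * v j)] (mod int p)"
    if "j \<in> {1..h}" for j
    using mixed_term_reflect(1)[OF \<beta>, of "2 * j"] that p_eq by (simp add: c_def v_def)
  have triangle: "[(\<Sum>i=1..h. \<Sum>j=1..h - i. \<alpha> ^ i * v i * (\<beta> ^ j * v j))
      = dsum h (\<lambda>n. \<beta> ^ n * v n) (\<lambda>i. (\<alpha> * \<beta>) ^ i * v i)
        + dsum h (\<lambda>n. \<alpha> ^ n * v n) (\<lambda>i. (\<alpha> * \<beta>) ^ i * v i)] (mod int p)"
  proof -
    have pow: "\<gamma> ^ (n - i) = \<gamma> ^ n * \<gamma> ^ i" if "i < n" "\<gamma> \<in> {1, -1}" for i n and \<gamma> :: int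
    proof -
      have "\<gamma> ^ n = \<gamma> ^ (n - i) * \<gamma> ^ i" using that by (simp flip: power_add)
      moreover have "\<gamma> ^ i * \<gamma> ^ i = 1" using that(2) by (auto simp flip: power_mult_distrib)
      ultimately show ?thesis by (simp add: mult.assoc)
    qed
    \<comment> \<open>For fixed \<open>n\<close>, 1/(i (n - i)) splits into 1/(n i) + 1/(n (n - i));
      \<open>?x\<close> and \<open>?y\<close> are the two parts with their signs. Replacing
      \<open>i\<close> by \<open>n - i\<close> gives \<open>?y\<close> the shape of
      \<open>?x\<close> with \<alpha> and \<beta> exchanged.\<close>
    let ?x = "\<lambda>n i. \<beta> ^ n * v n * ((\<alpha> * \<beta>) ^ i * v i)"
    let ?y = "\<lambda>n i. \<alpha> ^ i * \<beta> ^ (n - i) * v n * v (n - i)"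
    have "[(\<Sum>n=1..h. \<Sum>i=1..<n. \<alpha> ^ i * v i * (\<beta> ^ (n - i) * v (n - i)))
        = (\<Sum>n=1..h. \<Sum>i=1..<n. ?x n i + ?y n i)] (mod int p)"
    proof (intro cong_sum)
      fix n i assume "n \<in> {1..h}" "i \<in> {1..<n}"
      moreover from this have "1 \<le> n - i" "n - i \<le> h" by auto
      ultimately have "[v i * v (n - i) = v n * (v i + v (n - i))] (mod int p)"
        using pinv_partial_fraction[of "2 * i" "2 * (n - i)"] unfolding v_def
        by (simp flip: distrib_left)
      hence "[\<alpha> ^ i * \<beta> ^ (n - i) * (v i * v (n - i))
          = \<alpha> ^ i * \<beta> ^ (n - i) * (v n * (v i + v (n - i)))] (mod int p)"
        by (rule cong_mult[OF cong_refl])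
      moreover have "\<beta> ^ n * v n * ((\<alpha> * \<beta>) ^ i * v i) = \<alpha> ^ i * \<beta> ^ (n - i) * (v n * v i)"
      proof -
        have "\<beta> ^ n * v n * ((\<alpha> * \<beta>) ^ i * v i) = \<alpha> ^ i * (\<beta> ^ n * \<beta> ^ i) * (v n * v i)"
          by (simp only: power_mult_distrib mult_ac)
        also have "\<beta> ^ n * \<beta> ^ i = \<beta> ^ (n - i)"
          using \<open>i \<in> {1..<n}\<close> \<beta> by (intro pow[symmetric]) auto
        finally show ?thesis .
      qed
      ultimately show "[\<alpha> ^ i * v i * (\<beta> ^ (n - i) * v (n - i))
          = \<beta> ^ n * v n * ((\<alpha> * \<beta>) ^ i * v i) + \<alpha> ^ i * \<beta> ^ (n - i) * v n * v (n - i)] (mod int p)"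
        by (simp only: distrib_left mult_ac)
    qed
    moreover have "(\<Sum>n=1..h. \<Sum>i=1..<n. ?x n i)
        = dsum h (\<lambda>n. \<beta> ^ n * v n) (\<lambda>i. (\<alpha> * \<beta>) ^ i * v i)"
      by (simp add: dsum_def sum_distrib_left)
    moreover have "(\<Sum>n=1..h. \<Sum>i=1..<n. ?y n i)
        = dsum h (\<lambda>n. \<alpha> ^ n * v n) (\<lambda>i. (\<alpha> * \<beta>) ^ i * v i)"
      unfolding dsum_def sum_distrib_left
    proof (rule sum.cong[OF refl])
      fix n
      show "(\<Sum>i=1..<n. \<alpha> ^ i * \<beta> ^ (n - i) * v n * v (n - i))
          = (\<Sum>i=1..<n. \<alpha> ^ n * v n * ((\<alpha> * \<beta>) ^ i * v i))"
        by (rule sum.reindex_bij_witness[where i = "\<lambda>i. n - i" and j = "\<lambda>i. n - i"])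
          (use \<alpha> in \<open>auto simp: pow power_mult_distrib mult_ac\<close>)
    qed
    ultimately show ?thesis by (simp only: sum_triangle sum.distrib)
  qed
  let ?a = "\<Sum>i=1..h. \<alpha> ^ i * v i" and ?b = "\<Sum>j=1..h. \<beta> ^ j * v j"
  let ?t = "\<Sum>i=1..h. \<Sum>j=1..h - i. \<alpha> ^ i * v i * (\<beta> ^ j * v j)"
  let ?o = "\<lambda>j. mixed_term p (-1) \<beta> (Suc (2 * h) - 2 * j)"
  have prod: "[?a * (\<Sum>j=1..h. ?o j) = ?a * (c * ?b)] (mod int p)"
    unfolding sum_distrib_left[of c] by (intro cong_mult cong_refl cong_sum reflect)
  have "[(\<Sum>i=1..h. \<Sum>j=1..h - i. \<alpha> ^ i * v i * ?o j)
      = (\<Sum>i=1..h. \<Sum>j=1..h - i. \<alpha> ^ i * v i * (c * (\<beta> ^ j * v j)))] (mod int p)"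
    by (intro cong_mult cong_refl cong_sum reflect) auto
  moreover have "(\<Sum>i=1..h. \<Sum>j=1..h - i. \<alpha> ^ i * v i * (c * (\<beta> ^ j * v j))) = c * ?t"
    by (simp only: sum_distrib_left mult_ac)
  ultimately have corner:
    "[(\<Sum>i=1..h. \<Sum>j=1..h - i. \<alpha> ^ i * v i * ?o j) = c * ?t] (mod int p)"
    by (simp only:)
  have "dsum (2 * h) (mixed_term p 1 \<alpha>) (mixed_term p (-1) \<beta>)
      = ?a * (\<Sum>j=1..h. ?o j) - (\<Sum>i=1..h. \<Sum>j=1..h - i. \<alpha> ^ i * v i * ?o j)"
    by (subst dsum_even_odd_indices) (simp_all add: v_def)
  hence main: "[dsum (2 * h) (mixed_term p 1 \<alpha>) (mixed_term p (-1) \<beta>) = ?a * (c * ?b) - c * ?t] (mod int p)"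
    by (simp only: cong_diff[OF prod corner])
  have factor: "?a * (c * ?b) - c * ?t = c * (?a * ?b - ?t)"
    by (simp only: right_diff_distrib mult.left_commute)
  have "[c * (?a * ?b - ?t) = c * (?a * ?b
        - (dsum h (\<lambda>n. \<beta> ^ n * v n) (\<lambda>i. (\<alpha> * \<beta>) ^ i * v i)
          + dsum h (\<lambda>n. \<alpha> ^ n * v n) (\<lambda>i. (\<alpha> * \<beta>) ^ i * v i)))] (mod int p)"
    by (intro cong_mult cong_diff cong_refl triangle)
  from cong_trans[OF main[unfolded factor] this] show ?thesis
    by (simp add: dsum_even_indices sum_even_indices c_def v_def diff_diff_eq)
qed

text \<open>Halving both even indices costs two factors \<open>pinv p 2\<close>, which the 4
  absorbs; the indices now run up to \<open>h\<close>, that is, below p/2.\<close>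

lemma four_dsum_even_even:
  "[4 * dsum (2 * h) (mixed_term p 1 1) (mixed_term p 1 \<alpha>)
    = dsum h (pinv p) (\<lambda>k. \<alpha> ^ k * pinv p k)] (mod int p)"
proof -
  have "4 * dsum (2 * h) (mixed_term p 1 1) (mixed_term p 1 \<alpha>)
      = 4 * dsum h (\<lambda>j. pinv p 2 * pinv p j) (\<lambda>j. pinv p 2 * (\<alpha> ^ j * pinv p j))"
    by (simp add: dsum_even_indices pinv_mult mult.left_commute)
  also have "\<dots> = (2 * pinv p 2) ^ 2 * dsum h (pinv p) (\<lambda>k. \<alpha> ^ k * pinv p k)"
    by (simp add: dsum_mult power2_eq_square)
  also have "[\<dots> = 1 ^ 2 * dsum h (pinv p) (\<lambda>k. \<alpha> ^ k * pinv p k)] (mod int p)"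
    by (intro cong_mult cong_pow cong_refl two_pinv_two)
  finally show ?thesis by simp
qed

text \<open>
  Splitting the double sum over even \<open>k\<close> and odd \<open>l < k\<close> at \<open>p/2\<close>: by the reflection
  \<open>(k, l) \<mapsto> (p - l, p - k)\<close> the two outer pieces agree, and the mixed piece is a product.
\<close>
lemma dsum_even_odd_split:
  "[dsum (2 * h) (mixed_term p 1 1) (mixed_term p (-1) 1)
    = 2 * dsum h (mixed_term p 1 1) (mixed_term p (-1) 1)
      - (\<Sum>k=1..h. mixed_term p (-1) 1 k) ^ 2] (mod int p)"
proof -
  let ?e = "mixed_term p 1 1" and ?o = "mixed_term p (-1) 1"
  have reflect: "[?e (h + (Suc h - k)) = - ?o k] (mod int p)" "[?o (h + (Suc h - k)) = - ?e k] (mod int p)"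
    if "k \<in> {1..h}" for k
  proof -
    have "h + (Suc h - k) = p - k" "k \<in> {1..2*h}" using that p_eq by auto
    thus "[?e (h + (Suc h - k)) = - ?o k] (mod int p)" "[?o (h + (Suc h - k)) = - ?e k] (mod int p)"
      using mixed_term_reflect[of 1 k] by simp_all
  qed
  \<comment> \<open>The upper block is reversed, so that its arguments become \<open>p - k\<close>
    with \<open>k \<le> h\<close>.\<close>
  have split: "dsum (2 * h) ?e ?o
      = dsum h ?e ?o + (\<Sum>k=1..h. ?e (h + (Suc h - k))) * (\<Sum>l=1..h. ?o l)
        + dsum h (\<lambda>k. ?o (h + (Suc h - k))) (\<lambda>k. ?e (h + (Suc h - k)))"
    using dsum_split[of h h ?e ?o] dsum_rev[of h "\<lambda>k. ?e (h + k)" "\<lambda>k. ?o (h + k)"]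
      sum_rev[of "\<lambda>k. ?e (h + k)" h] by (simp only: mult_2)
  have collect: "2 * dsum h ?e ?o - (\<Sum>k=1..h. ?o k) ^ 2
      = dsum h ?e ?o + (\<Sum>k=1..h. - ?o k) * (\<Sum>l=1..h. ?o l)
        + dsum h (\<lambda>k. - ?e k) (\<lambda>k. - ?o k)"
    using dsum_mult[of h "-1" ?e "-1" ?o] by (simp add: sum_negf power2_eq_square)
  show ?thesis unfolding split collect
    by (intro cong_add cong_mult cong_sum cong_refl dsum_cong reflect)
qed

section \<open>Single sums over even indices and over odd indices below p/2\<close>

lemma sum_mixed_term_even:
  "(\<Sum>k=1..2*h. mixed_term p 1 \<alpha> k) = pinv p 2 * (\<Sum>j=1..h. \<alpha> ^ j * pinv p j)"
  by (simp add: sum_even_indices pinv_mult sum_distrib_left mult.left_commute)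

lemma sum_squares_even:
  "(\<Sum>k=1..2*h. mixed_sign 1 \<alpha> k * pinv p k ^ 2)
    = pinv p 2 ^ 2 * (\<Sum>j=1..h. \<alpha> ^ j * pinv p j ^ 2)"
  by (simp add: sum_even_indices mixed_sign_even pinv_mult power_mult_distrib sum_distrib_left
      mult.left_commute)

lemma sum_minus_alternating:
  "(\<Sum>j=1..h. 1 ^ j * f j) - (\<Sum>j=1..h. (-1) ^ j * f j)
    = 2 * (\<Sum>j=1..h. if odd j then f j else 0)" for f :: "nat \<Rightarrow> int"
  unfolding sum_distrib_left sum_subtractf[symmetric] by (rule sum.cong) auto

text \<open>Halving the even index leads to sums over all \<open>j \<le> h\<close>; their difference
  keeps only the odd \<open>j\<close>, doubled, and this 2 cancels the factor 1/2.\<close>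

lemma half_sum_odd:
  "[(\<Sum>k=1..2*h. mixed_term p 1 1 k) - (\<Sum>k=1..2*h. mixed_term p 1 (-1) k)
    = (\<Sum>k=1..h. mixed_term p (-1) 1 k)] (mod int p)"
proof -
  have "(\<Sum>k=1..2*h. mixed_term p 1 1 k) - (\<Sum>k=1..2*h. mixed_term p 1 (-1) k)
      = 2 * pinv p 2 * (\<Sum>k=1..h. mixed_term p (-1) 1 k)"
    unfolding sum_mixed_term_even right_diff_distrib[symmetric] sum_minus_alternating
    by (simp add: mixed_term_def mixed_sign_odd if_distrib[of "\<lambda>x. x * _"] cong: if_cong)
  also have "[\<dots> = 1 * (\<Sum>k=1..h. mixed_term p (-1) 1 k)] (mod int p)"
    by (intro cong_mult cong_refl two_pinv_two)
  finally show ?thesis by simp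
qed

text \<open>As in weight 1, but the squares produce 1/4 in place of 1/2, hence the 2 on the
  left.\<close>

lemma half_sum_squares_odd:
  "[2 * ((\<Sum>k=1..2*h. mixed_sign 1 1 k * pinv p k ^ 2)
      - (\<Sum>k=1..2*h. mixed_sign 1 (-1) k * pinv p k ^ 2))
    = (\<Sum>k=1..h. mixed_term p (-1) 1 k * mixed_term p (-1) 1 k)] (mod int p)"
proof -
  have "2 * ((\<Sum>k=1..2*h. mixed_sign 1 1 k * pinv p k ^ 2)
      - (\<Sum>k=1..2*h. mixed_sign 1 (-1) k * pinv p k ^ 2))
    = (2 * pinv p 2) ^ 2 * (\<Sum>k=1..h. mixed_term p (-1) 1 k * mixed_term p (-1) 1 k)"
    unfolding sum_squares_even right_diff_distrib[symmetric] sum_minus_alternating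
    by (simp add: mixed_term_def mixed_sign_odd power2_eq_square if_distrib[of "\<lambda>x. x * _"]
        cong: if_cong)
  also have "[\<dots> = 1 ^ 2 * (\<Sum>k=1..h. mixed_term p (-1) 1 k * mixed_term p (-1) 1 k)] (mod int p)"
    by (intro cong_mult cong_pow cong_refl two_pinv_two)
  finally show ?thesis by simp
qed

text \<open>After halving, the left side is twice the double sum of 1/(k l) over
  \<open>l < k \<le> h\<close> with \<open>l\<close> odd. For odd \<open>k\<close> the stuffle
  product applies, for even \<open>k\<close> the splitting at p/2. The other sums involved can be
  evaluated independently, so this determines the double sum with signs 1 and -1.\<close>

lemma dsum_even_alternating:
  "[4 * dsum (2 * h) (mixed_term p 1 1) (mixed_term p 1 1)
      - 4 * dsum (2 * h) (mixed_term p 1 1) (mixed_term p 1 (-1))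
    = dsum (2 * h) (mixed_term p 1 1) (mixed_term p (-1) 1)
      + 2 * ((\<Sum>k=1..2*h. mixed_term p 1 1 k) - (\<Sum>k=1..2*h. mixed_term p 1 (-1) k)) ^ 2
      - 2 * ((\<Sum>k=1..2*h. mixed_sign 1 1 k * pinv p k ^ 2)
        - (\<Sum>k=1..2*h. mixed_sign 1 (-1) k * pinv p k ^ 2))] (mod int p)"
proof -
  let ?e = "mixed_term p 1 1" and ?o = "mixed_term p (-1) 1"
  have odd: "?o k = (if odd k then pinv p k else 0)" for k
    by (simp add: mixed_term_def mixed_sign_odd)
  have sum: "pinv p = (\<lambda>k. ?e k + ?o k)"
    by (auto simp: mixed_term_def mixed_sign_even mixed_sign_odd)
  have odd_part: "(\<lambda>k. 1 ^ k * pinv p k) = (\<lambda>k. (-1) ^ k * pinv p k + 2 * ?o k)"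
    by (auto simp: odd)
  have "dsum h (pinv p) (\<lambda>k. 1 ^ k * pinv p k) - dsum h (pinv p) (\<lambda>k. (-1) ^ k * pinv p k)
      = 2 * dsum h (pinv p) ?o"
    using dsum_mult[of h 1 "pinv p" 2 ?o] unfolding odd_part by (simp add: dsum_add_right)
  also have "\<dots> = 2 * dsum h ?e ?o + 2 * dsum h ?o ?o"
    unfolding sum dsum_add_left by simp
  \<comment> \<open>The odd-odd part is replaced by the square minus the diagonal; one more square
    is added and subtracted to match the splitting at p/2.\<close>
  also have "\<dots> = (2 * dsum h ?e ?o - (\<Sum>k=1..h. ?o k) ^ 2) + 2 * (\<Sum>k=1..h. ?o k) ^ 2
      - (\<Sum>k=1..h. ?o k * ?o k)"
    using dsum_stuffle[of h ?o ?o] by (simp add: power2_eq_square)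
  finally have eq: "dsum h (pinv p) (\<lambda>k. 1 ^ k * pinv p k) - dsum h (pinv p) (\<lambda>k. (-1) ^ k * pinv p k)
      = \<dots>" .
  have half: "[4 * dsum (2 * h) ?e ?e - 4 * dsum (2 * h) ?e (mixed_term p 1 (-1))
      = dsum h (pinv p) (\<lambda>k. 1 ^ k * pinv p k) - dsum h (pinv p) (\<lambda>k. (-1) ^ k * pinv p k)] (mod int p)"
    by (intro cong_diff four_dsum_even_even)
  show ?thesis
    by (rule cong_trans[OF half[unfolded eq]])
      (intro cong_diff cong_add cong_mult cong_pow cong_refl
        cong_sym[OF dsum_even_odd_split] cong_sym[OF half_sum_odd] cong_sym[OF half_sum_squares_odd])
qed

text \<open>Modulo p, the sum of all 1/k^2 is twice \<open>?B\<close> by reflecting odd indices to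
  even ones, and twice \<open>?H\<close> by reflecting the upper half to the lower one. As
  \<open>?H\<close> is 4 times \<open>?B\<close>, this leaves 8 \<open>?B\<close> congruent to 2
  \<open>?B\<close>.\<close>

lemma six_sum_squares_even: "[6 * (\<Sum>k=1..2*h. mixed_sign 1 1 k * pinv p k ^ 2) = 0] (mod int p)"
proof -
  let ?H = "\<Sum>k=1..h. pinv p k ^ 2" and ?B = "\<Sum>k=1..2*h. mixed_sign 1 1 k * pinv p k ^ 2"
  have "4 * ?B = (2 * pinv p 2) ^ 2 * ?H"
    unfolding sum_squares_even by (simp add: power_mult_distrib)
  also have "[\<dots> = 1 ^ 2 * ?H] (mod int p)"
    by (intro cong_mult cong_pow cong_refl two_pinv_two)
  finally have H: "[4 * ?B = ?H] (mod int p)" by simp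
  have "(\<Sum>k=1..2*h. pinv p k ^ 2) = ?B + (\<Sum>k=1..2*h. mixed_sign (-1) 1 k * pinv p k ^ 2)"
    by (auto simp: mixed_sign_even mixed_sign_odd simp flip: sum.distrib intro!: sum.cong)
  also have "[\<dots> = ?B + - reflection_sign 1 h * ?B] (mod int p)"
    by (intro cong_add cong_refl sum_squares_odd_reflect) simp
  finally have T: "[(\<Sum>k=1..2*h. pinv p k ^ 2) = 2 * ?B] (mod int p)" by simp
  have "(\<Sum>k=1..2*h. pinv p k ^ 2) = ?H + (\<Sum>k=1..h. pinv p (h + k) ^ 2)"
  proof -
    have "(\<Sum>k=1..h + n. pinv p k ^ 2) = ?H + (\<Sum>k=1..n. pinv p (h + k) ^ 2)" for n
      by (induction n) (simp_all add: add.assoc)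
    thus ?thesis by (simp add: mult_2)
  qed
  also have "\<dots> = ?H + (\<Sum>k=1..h. pinv p (h + (Suc h - k)) ^ 2)"
    by (subst sum_rev[of "\<lambda>k. pinv p (h + k) ^ 2"]) (rule refl)
  also have "[\<dots> = ?H + (\<Sum>k=1..h. (- pinv p k) ^ 2)] (mod int p)"
  proof (intro cong_add cong_refl cong_sum cong_pow)
    fix k assume "k \<in> {1..h}"
    hence "h + (Suc h - k) = p - k" "k \<le> p" using p_eq by auto
    thus "[pinv p (h + (Suc h - k)) = - pinv p k] (mod int p)" using pinv_reflect by simp
  qed
  finally have T': "[(\<Sum>k=1..2*h. pinv p k ^ 2) = ?H + ?H] (mod int p)" by simp
  have "[4 * ?B + 4 * ?B = 2 * ?B] (mod int p)"
    by (rule cong_trans[OF cong_trans[OF cong_add[OF H H] cong_sym[OF T']] T])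
  thus ?thesis by (simp add: cong_iff_dvd_diff)
qed

section \<open>Fermat quotients from binomial coefficients\<close>

lemma choose_prime_minus_1: "k < p \<Longrightarrow> [int ((p - 1) choose k) = (-1) ^ k] (mod int p)"
proof (induction k)
  case (Suc k)
  \<comment> \<open>In Pascal's rule the left side is divisible by p, so neighbours in row
    \<open>p - 1\<close> are negatives of each other modulo p.\<close>
  have "p choose Suc k = ((p - 1) choose k) + ((p - 1) choose Suc k)"
    using p_eq by simp
  moreover have "p dvd (p choose Suc k)"
    using Suc.prems prime p_eq by (intro dvd_choose_prime) auto
  ultimately have "int p dvd int ((p - 1) choose k) + int ((p - 1) choose Suc k)"
    by (metis of_nat_add of_nat_dvd_iff)
  moreover have "int p dvd int ((p - 1) choose k) - (-1) ^ k"
    using Suc by (simp add: cong_iff_dvd_diff)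
  ultimately have "int p dvd (int ((p - 1) choose k) + int ((p - 1) choose Suc k))
      - (int ((p - 1) choose k) - (-1) ^ k)"
    by (rule dvd_diff)
  thus ?case by (simp add: cong_iff_dvd_diff)
qed simp

text \<open>From k C(p, k) = p C(p - 1, k - 1) at k = \<open>2 * j\<close>, where the coefficient on
  the right is congruent to -1.\<close>

lemma choose_prime_even:
  assumes "j \<in> {1..h}"
  obtains c where "int (p choose (2 * j)) = int p * c" "[c = - pinv p (2 * j)] (mod int p)"
proof -
  have j: "2 * j \<in> {1..2*h}" using assms by auto
  have "p dvd (p choose (2 * j))"
    using j prime p_eq by (intro dvd_choose_prime) auto
  then obtain c where c: "p choose (2 * j) = p * c" by (elim dvdE)
  have "2 * j * (p choose (2 * j)) = p * ((p - 1) choose (2 * j - 1))"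
    using assms by (intro times_binomial_minus1_eq) auto
  hence "2 * j * c = (p - 1) choose (2 * j - 1)"
    using c p_eq by (simp add: mult.left_commute[of _ "Suc _"] del: mult_Suc)
  hence "int (2 * j) * int c = int ((p - 1) choose (2 * j - 1))" by (simp flip: of_nat_mult)
  also have "[\<dots> = (-1) ^ (2 * j - 1)] (mod int p)"
    using j p_eq by (intro choose_prime_minus_1) auto
  also have "(-1) ^ (2 * j - 1) = (-1 :: int)" using assms by (intro neg_one_odd_power) auto
  finally have "[- (int (2 * j) * int c) = - (-1)] (mod int p)" by (subst cong_minus_minus_iff)
  hence "[int (2 * j) * - int c = 1] (mod int p)" by simp
  hence "[- int c = pinv p (2 * j)] (mod int p)" by (rule pinv_unique[OF j])
  hence "[int c = - pinv p (2 * j)] (mod int p)"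
    using cong_minus_minus_iff[of "- int c" "pinv p (2 * j)" "int p"] by simp
  thus thesis using that[of "int c"] c by simp
qed

text \<open>The term \<open>j = 0\<close> is 1 and all others are divisible by p. Comparison with a
  closed form of the left side then expresses the single sum by the Fermat quotient.\<close>

lemma choose_prime_sum:
  assumes "\<alpha> \<in> {1, -1}"
  obtains t where "(\<Sum>j\<le>h. \<alpha> ^ j * int (p choose (2 * j))) = 1 + int p * t"
    "[t = - (\<Sum>k=1..2*h. mixed_term p 1 \<alpha> k)] (mod int p)"
proof -
  have "\<forall>j\<in>{1..h}. \<exists>c. int (p choose (2 * j)) = int p * c \<and> [c = - pinv p (2 * j)] (mod int p)"
  proof
    fix j assume "j \<in> {1..h}"
    from choose_prime_even[OF this]
    show "\<exists>c. int (p choose (2 * j)) = int p * c \<and> [c = - pinv p (2 * j)] (mod int p)"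
      by blast
  qed
  from bchoice[OF this] obtain c where
    c: "\<forall>j\<in>{1..h}. int (p choose (2 * j)) = int p * c j \<and> [c j = - pinv p (2 * j)] (mod int p)" ..
  let ?t = "\<Sum>j=1..h. \<alpha> ^ j * c j"
  have "(\<Sum>j\<le>h. \<alpha> ^ j * int (p choose (2 * j)))
      = 1 + (\<Sum>j=1..h. \<alpha> ^ j * int (p choose (2 * j)))"
    by (simp add: atMost_atLeast0 sum.atLeast_Suc_atMost)
  also have "(\<Sum>j=1..h. \<alpha> ^ j * int (p choose (2 * j))) = int p * ?t"
    unfolding sum_distrib_left
    by (rule sum.cong) (use c in \<open>auto simp: mult.left_commute\<close>)
  finally have eq: "(\<Sum>j\<le>h. \<alpha> ^ j * int (p choose (2 * j))) = 1 + int p * ?t" .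
  have "[?t = (\<Sum>j=1..h. \<alpha> ^ j * - pinv p (2 * j))] (mod int p)"
    by (intro cong_sum cong_mult cong_refl) (use c in auto)
  moreover have "(\<Sum>j=1..h. \<alpha> ^ j * - pinv p (2 * j)) = - (\<Sum>k=1..2*h. mixed_term p 1 \<alpha> k)"
    by (simp add: sum_even_indices sum_negf)
  ultimately show thesis using that[OF eq] by (simp only:)
qed

lemma sum_choose_even: "(\<Sum>j\<le>h. int (p choose (2 * j))) = 2 ^ (p - 1)"
proof -
  have "2 * (\<Sum>i\<le>p. if even i then of_nat (p choose i) else 0) = (2 ^ p :: int)"
    using p_eq by (intro choose_even_sum) simp
  moreover have "(\<Sum>i\<le>Suc (2 * n). if even i then f i else 0) = (\<Sum>j\<le>n. f (2 * j))"
    for n and f :: "nat \<Rightarrow> int" by (induction n) simp_all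
  ultimately show ?thesis unfolding p_eq by simp
qed

text \<open>The alternating sum is the real part of \<open>(1 + \<i>) ^ p\<close>, whose square is purely imaginary.\<close>
lemma sum_choose_even_alternating: "(\<Sum>j\<le>h. (-1) ^ j * int (p choose (2 * j))) ^ 2 = 2 ^ (p - 1)"
proof -
  define z where "z = (1 + \<i>) ^ p"
  have "z = (\<Sum>k\<le>p. of_nat (p choose k) * \<i> ^ k)"
    using binomial_ring[of \<i> 1 p] by (simp add: z_def add.commute)
  hence "Re z = (\<Sum>k\<le>p. real (p choose k) * Re (\<i> ^ k))" by simp
  moreover have "(\<Sum>k\<le>Suc (2 * n). f k * Re (\<i> ^ k)) = (\<Sum>j\<le>n. (-1) ^ j * f (2 * j))"
    for n and f :: "nat \<Rightarrow> real"
  proof (induction n)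
    case (Suc n)
    have "\<i> ^ (2 * m) = of_real ((-1) ^ m)" "\<i> ^ Suc (2 * m) = \<i> * of_real ((-1) ^ m)" for m
      by (simp_all add: power_mult)
    from this[of "Suc n"] show ?case using Suc by simp
  qed simp
  ultimately have Re: "Re z = of_int (\<Sum>j\<le>h. (-1) ^ j * int (p choose (2 * j)))"
    unfolding p_eq by simp
  have "z ^ 2 = ((1 + \<i>) ^ 2) ^ p" by (simp add: z_def mult.commute flip: power_mult)
  also have "(1 + \<i>) ^ 2 = 2 * \<i>" by (simp add: power2_eq_square algebra_simps)
  also have "(2 * \<i>) ^ p = 2 * \<i> * of_real ((-4) ^ h)"
    unfolding p_eq by (simp add: power_mult power_mult_distrib)
  finally have "Re (z ^ 2) = 0" by simp
  \<comment> \<open>Hence both squares are half of the squared modulus \<open>2 ^ p\<close>.\<close>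
  hence "Re z ^ 2 = Im z ^ 2" by (simp add: power2_eq_square)
  moreover have "Re z ^ 2 + Im z ^ 2 = 2 ^ p"
  proof -
    have "Re z ^ 2 + Im z ^ 2 = cmod z ^ 2" by (simp add: cmod_power2)
    also have "\<dots> = (cmod (1 + \<i>) ^ 2) ^ p"
      by (simp add: z_def norm_power mult.commute flip: power_mult)
    also have "cmod (1 + \<i>) ^ 2 = 2" by (simp add: cmod_power2)
    finally show ?thesis .
  qed
  ultimately have "2 * Re z ^ 2 = 2 * 2 ^ (p - 1)" unfolding p_eq by simp
  hence "real_of_int ((\<Sum>j\<le>h. (-1) ^ j * int (p choose (2 * j))) ^ 2) = of_int (2 ^ (p - 1))"
    by (simp add: Re)
  thus ?thesis by (simp only: of_int_eq_iff)
qed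

lemma sum_even_fermat_quotient:
  "[(\<Sum>k=1..2*h. mixed_term p 1 1 k) = - ((2 ^ (p - 1) - 1) div int p)] (mod int p)"
proof -
  obtain t where t: "(\<Sum>j\<le>h. 1 ^ j * int (p choose (2 * j))) = 1 + int p * t"
    "[t = - (\<Sum>k=1..2*h. mixed_term p 1 1 k)] (mod int p)"
    by (rule choose_prime_sum[of 1]) auto
  have "2 ^ (p - 1) - 1 = int p * t" using t(1) sum_choose_even by simp
  hence "(2 ^ (p - 1) - 1) div int p = t" using p_eq by simp
  with iffD2[OF cong_minus_minus_iff t(2)] show ?thesis by (simp add: cong_sym)
qed

text \<open>Here it is the square of 1 + p t that equals \<open>2 ^ (p - 1)\<close>; the Fermat
  quotient is 2 t + p t^2, congruent to 2 t, hence the factor 2.\<close>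

lemma sum_even_alternating_fermat_quotient:
  "[2 * (\<Sum>k=1..2*h. mixed_term p 1 (-1) k) = - ((2 ^ (p - 1) - 1) div int p)] (mod int p)"
proof -
  obtain t where t: "(\<Sum>j\<le>h. (-1) ^ j * int (p choose (2 * j))) = 1 + int p * t"
    "[t = - (\<Sum>k=1..2*h. mixed_term p 1 (-1) k)] (mod int p)"
    by (rule choose_prime_sum[of "-1"]) auto
  have "2 ^ (p - 1) - 1 = int p * (2 * t + int p * t ^ 2)"
    using sum_choose_even_alternating t(1) by (simp add: power2_eq_square algebra_simps)
  hence "(2 ^ (p - 1) - 1) div int p = 2 * t + int p * t ^ 2" using p_eq by simp
  moreover have "[2 * t + int p * t ^ 2 = 2 * t] (mod int p)" by (simp add: cong_iff_dvd_diff)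
  moreover have "[2 * t = 2 * - (\<Sum>k=1..2*h. mixed_term p 1 (-1) k)] (mod int p)"
    by (intro cong_mult cong_refl t)
  ultimately have "[(2 ^ (p - 1) - 1) div int p
      = 2 * - (\<Sum>k=1..2*h. mixed_term p 1 (-1) k)] (mod int p)"
    by (simp only: cong_trans[of "2 * t + int p * t ^ 2" "2 * t"])
  from iffD2[OF cong_minus_minus_iff this] show ?thesis by (simp add: cong_sym)
qed

text \<open>By Fermat, 1/k^2 is congruent to k^(p - 3), so the sum is an alternating power sum; the
  Euler polynomials at p and -p that evaluate it both reduce to the Euler number.\<close>

lemma sum_squares_euler_number:
  "[(\<Sum>k=1..2*h. mixed_sign 1 (-1) k * pinv p k ^ 2)
    = (-1) ^ h * residue p (euler_number (p - 3) / 2)] (mod int p)"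
proof -
  let ?B = "\<Sum>k=1..2*h. mixed_sign 1 (-1) k * pinv p k ^ 2" and ?n = "p - 3"
  have n: "even ?n" "?n > 0" using p_eq h_ge by auto
  have coprime: "\<not> int p dvd 2" "\<not> int p dvd 4"
    using not_dvd[of 2] not_dvd[of 4] h_ge by simp_all
  let ?S = "\<Sum>j=1..h. (-1) ^ j * (2 * int j) ^ ?n" and ?r = "residue p (euler_number ?n / 2)"
  have B: "?B = (\<Sum>j=1..h. (-1) ^ j * pinv p (2 * j) ^ 2)"
    by (simp add: sum_even_indices mixed_sign_even)
  have "[?B = ?S] (mod int p)"
    unfolding B
  proof (intro cong_sum cong_mult cong_refl)
    fix j assume "j \<in> {1..h}"
    hence j: "2 * j \<in> {1..2*h}" by auto
    have "p - 2 = Suc ?n" using p_eq h_ge by simp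
    hence "pinv p (2 * j) = int (2 * j) * int (2 * j) ^ ?n" by (simp only: pinv_def power_Suc)
    hence "pinv p (2 * j) ^ 2 = int (2 * j) * pinv p (2 * j) * int (2 * j) ^ ?n"
      by (simp only: power2_eq_square mult_ac)
    also have "[\<dots> = 1 * int (2 * j) ^ ?n] (mod int p)"
      by (intro cong_mult cong_refl pinv_inverse j)
    finally show "[pinv p (2 * j) ^ 2 = (2 * int j) ^ ?n] (mod int p)" by simp
  qed
  hence B_S: "[4 * ?B = 4 * ?S] (mod int p)" by (rule cong_mult[OF cong_refl])
  have S: "4 * ?S = (-1) ^ h * (euler_poly ?n (int p) + euler_poly ?n (- int p))"
    using alternating_power_sum[OF n, of h] p_eq by (simp add: add.commute)
  have S_euler: "[4 * ?S = (-1) ^ h * (euler_int ?n + euler_int ?n)] (mod int p)"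
    unfolding S using euler_poly_cong[of ?n "int p"] euler_poly_cong[of ?n "- int p"]
    by (intro cong_mult cong_add cong_refl) simp_all
  have "[?r * 2 = euler_int ?n] (mod int p)"
    by (rule residue_cong[OF prime coprime(1)]) simp
  hence "[(-1) ^ h * (?r * 2 + ?r * 2) = (-1) ^ h * (euler_int ?n + euler_int ?n)] (mod int p)"
    by (intro cong_mult cong_add cong_refl)
  from cong_trans[OF cong_trans[OF B_S S_euler] cong_sym[OF this]]
  have "[4 * ?B = 4 * ((-1) ^ h * ?r)] (mod int p)"
    by (simp add: algebra_simps)
  thus ?thesis by (rule cong_cancel[OF coprime(2)])
qed

end

section \<open>Relations among the values of weight 2\<close>

text \<open>The rational \<open>r\<close> is p-integral with residue \<open>x\<close>. An arbitrary
  fraction as witness, in place of the lowest terms in \<open>residue\<close>, makes this stable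
  under sums and products at a fixed prime.\<close>

definition represents :: "nat \<Rightarrow> int \<Rightarrow> rat \<Rightarrow> bool" where
  "represents p x r \<longleftrightarrow>
    (\<exists>a b. \<not> int p dvd b \<and> r = of_int a / of_int b \<and> [x * b = a] (mod int p))"

context large_prime begin

lemma p_minus_1: "p - Suc 0 = 2 * h"
  using p_eq by simp

lemma represents_residue:
  assumes "represents p x r"
  shows "[residue p r = x] (mod int p)"
proof -
  obtain a b where ab: "\<not> int p dvd b" "r = of_int a / of_int b" "[x * b = a] (mod int p)"
    using assms by (auto simp: represents_def)
  from cong_trans[OF residue_cong[OF prime ab(1,2)] cong_sym[OF ab(3)]] show ?thesis
    by (rule residue_cancel[OF prime ab(1)])
qed

lemma not_dvd_mult: "\<not> int p dvd b \<Longrightarrow> \<not> int p dvd d \<Longrightarrow> \<not> int p dvd b * d"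
  using prime by (simp add: prime_dvd_mult_iff)

lemma represents_add:
  assumes "represents p x r" "represents p y s"
  shows "represents p (x + y) (r + s)"
proof -
  obtain a b where ab: "\<not> int p dvd b" "r = of_int a / of_int b" "[x * b = a] (mod int p)"
    using assms(1) by (auto simp: represents_def)
  obtain c d where cd: "\<not> int p dvd d" "s = of_int c / of_int d" "[y * d = c] (mod int p)"
    using assms(2) by (auto simp: represents_def)
  have "b \<noteq> 0" "d \<noteq> 0" using ab(1) cd(1) by auto
  hence "r + s = of_int (a * d + c * b) / of_int (b * d)"
    using ab(2) cd(2) by (simp add: field_simps)
  moreover have "[x * b * d + y * d * b = a * d + c * b] (mod int p)"
    by (intro cong_add cong_mult cong_refl ab cd)
  hence "[(x + y) * (b * d) = a * d + c * b] (mod int p)"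
    by (simp add: algebra_simps)
  ultimately show ?thesis using not_dvd_mult[OF ab(1) cd(1)] unfolding represents_def by blast
qed

lemma represents_mult:
  assumes "represents p x r" "represents p y s"
  shows "represents p (x * y) (r * s)"
proof -
  obtain a b where ab: "\<not> int p dvd b" "r = of_int a / of_int b" "[x * b = a] (mod int p)"
    using assms(1) by (auto simp: represents_def)
  obtain c d where cd: "\<not> int p dvd d" "s = of_int c / of_int d" "[y * d = c] (mod int p)"
    using assms(2) by (auto simp: represents_def)
  have "r * s = of_int (a * c) / of_int (b * d)"
    using ab(2) cd(2) by simp
  moreover have "[(x * y) * (b * d) = a * c] (mod int p)"
    using cong_mult[OF ab(3) cd(3)] by (simp add: mult_ac)
  ultimately show ?thesis using not_dvd_mult[OF ab(1) cd(1)] unfolding represents_def by blast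
qed

lemma represents_of_int: "represents p x (of_int x)"
proof -
  have "\<not> int p dvd 1" using prime_gt_1_nat[OF prime] by simp
  thus ?thesis unfolding represents_def by (intro exI[of _ x] exI[of _ 1]) auto
qed

lemma represents_sum:
  assumes "\<And>i. i \<in> I \<Longrightarrow> represents p (x i) (r i)"
  shows "represents p (\<Sum>i\<in>I. x i) (\<Sum>i\<in>I. r i)"
  using assms represents_of_int[of 0]
  by (induction I rule: infinite_finite_induct) (auto intro!: represents_add)

lemma represents_power: "represents p x r \<Longrightarrow> represents p (x ^ n) (r ^ n)"
  using represents_of_int[of 1] by (induction n) (auto intro!: represents_mult)

lemma represents_pinv:
  assumes "k \<in> {1..2*h}"
  shows "represents p (pinv p k) (1 / of_nat k)"
  unfolding represents_def using not_dvd[OF assms] pinv_inverse[OF assms]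
  by (intro exI[of _ 1] exI[of _ "int k"]) (auto simp: mult.commute)

end

section \<open>Values of depth 1 and 2 as families of modular sums\<close>

lemma mixed_indices_single:
  assumes "\<epsilon> \<in> {1, -1}"
  shows "mixed_indices p [\<epsilon>] = (\<lambda>k. [k]) ` {k\<in>{1..p - 1}. \<epsilon> = 1 \<and> even k \<or> \<epsilon> = -1 \<and> odd k}"
proof (rule Set.set_eqI)
  fix ks
  have "ks \<in> mixed_indices p [\<epsilon>] \<longleftrightarrow> (\<exists>k. ks = [k] \<and> k \<in> {1..p - 1} \<and> (\<epsilon> = 1 \<and> even k \<or> \<epsilon> = -1 \<and> odd k))"
    using assms by (cases ks; cases "tl ks") (auto simp: mixed_indices_def)
  thus "ks \<in> mixed_indices p [\<epsilon>] \<longleftrightarrow>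
      ks \<in> (\<lambda>k. [k]) ` {k\<in>{1..p - 1}. \<epsilon> = 1 \<and> even k \<or> \<epsilon> = -1 \<and> odd k}"
    by (auto simp only: image_iff mem_Collect_eq bex_simps conj_ac ex_simps)
qed

text \<open>The parity condition moves from the index set into \<open>mixed_sign\<close>, which is 0
  off that set.\<close>

lemma mixed_sum_single:
  assumes "\<epsilon> \<in> {1, -1}"
  shows "mixed_sum p [s] [\<epsilon>] [\<alpha>] = (\<Sum>k=1..p - 1. of_int (mixed_sign \<epsilon> \<alpha> k) * (1 / of_nat k) ^ s)"
  unfolding mixed_sum_def mixed_indices_single[OF assms]
  by (subst sum.reindex, simp add: inj_on_def, rule sum.mono_neutral_cong_left)
    (auto simp: mixed_sign_def power_divide split: if_splits)

lemma mixed_indices_double: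
  assumes "\<epsilon> \<in> {1, -1}" "\<epsilon>' \<in> {1, -1}"
  shows "mixed_indices p [\<epsilon>, \<epsilon>'] = (\<lambda>(k, l). [k, l]) ` {(k, l)\<in>(SIGMA k:{1..p - 1}. {1..<k}).
    (\<epsilon> = 1 \<and> even k \<or> \<epsilon> = -1 \<and> odd k) \<and> (\<epsilon>' = 1 \<and> even l \<or> \<epsilon>' = -1 \<and> odd l)}"
proof (rule Set.set_eqI)
  let ?P = "\<lambda>\<epsilon> k. \<epsilon> = (1::int) \<and> even k \<or> \<epsilon> = -1 \<and> odd (k::nat)"
  fix ks
  have all: "(\<forall>j<Suc (Suc 0). Q j) \<longleftrightarrow> Q 0 \<and> Q 1" for Q by (auto simp: less_Suc_eq)
  have "ks \<in> mixed_indices p [\<epsilon>, \<epsilon>'] \<longleftrightarrow> (\<exists>k l. ks = [k, l] \<and>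
      k \<in> {1..p - 1} \<and> l \<in> {1..<k} \<and> ?P \<epsilon> k \<and> ?P \<epsilon>' l)"
    using assms
    by (cases ks; cases "tl ks"; cases "tl (tl ks)") (auto simp: mixed_indices_def all)
  thus "ks \<in> mixed_indices p [\<epsilon>, \<epsilon>'] \<longleftrightarrow> ks \<in> (\<lambda>(k, l). [k, l]) `
      {(k, l)\<in>(SIGMA k:{1..p - 1}. {1..<k}). ?P \<epsilon> k \<and> ?P \<epsilon>' l}"
    by (force simp: image_iff)
qed

lemma mixed_sum_double:
  assumes "\<epsilon> \<in> {1, -1}" "\<epsilon>' \<in> {1, -1}"
  shows "mixed_sum p [1, 1] [\<epsilon>, \<epsilon>'] [\<alpha>, \<beta>] = (\<Sum>k=1..p - 1. of_int (mixed_sign \<epsilon> \<alpha> k) * (1 / of_nat k)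
    * (\<Sum>l=1..<k. of_int (mixed_sign \<epsilon>' \<beta> l) * (1 / of_nat l)))"
proof -
  let ?P = "\<lambda>\<epsilon> k. \<epsilon> = (1::int) \<and> even k \<or> \<epsilon> = -1 \<and> odd (k::nat)"
  let ?t = "\<lambda>\<epsilon> \<alpha> k. of_int \<alpha> ^ nat ((2 * int k + 1 - \<epsilon>) div 4) / of_nat k :: rat"
  have "mixed_sum p [1, 1] [\<epsilon>, \<epsilon>'] [\<alpha>, \<beta>]
      = (\<Sum>(k, l)\<in>{(k, l)\<in>(SIGMA k:{1..p - 1}. {1..<k}). ?P \<epsilon> k \<and> ?P \<epsilon>' l}. ?t \<epsilon> \<alpha> k * ?t \<epsilon>' \<beta> l)"
    unfolding mixed_sum_def mixed_indices_double[OF assms]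
    by (subst sum.reindex) (auto simp: inj_on_def lessThan_Suc mult.commute intro!: sum.cong)
  also have "\<dots> = (\<Sum>(k, l)\<in>(SIGMA k:{1..p - 1}. {1..<k}).
      of_int (mixed_sign \<epsilon> \<alpha> k) * (1 / of_nat k) * (of_int (mixed_sign \<epsilon>' \<beta> l) * (1 / of_nat l)))"
    by (rule sum.mono_neutral_cong_left) (auto simp: mixed_sign_def split: if_splits)
  finally show ?thesis by (simp add: sum.Sigma sum_distrib_left)
qed

text \<open>Only the primes 2 and 3 escape \<open>large_prime\<close>, and finitely many primes do
  not matter in \<open>adele\<close>.\<close>

lemma adele_of_eqI:
  assumes "\<And>p h. large_prime p h \<Longrightarrow> [f p = g p] (mod int p)"
  shows "adele_of f = adele_of g"
proof -
  have "\<forall>\<^sub>F p in cofinite. p \<notin> {..3::nat}"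
    by (simp add: eventually_cofinite)
  hence "\<forall>\<^sub>F p in cofinite. prime p \<longrightarrow> [f p = g p] (mod int p)"
  proof eventually_elim
    case (elim p)
    show ?case
    proof
      assume "prime p"
      moreover have "odd p" using \<open>prime p\<close> elim by (intro prime_odd_nat) auto
      then obtain h where "p = Suc (2 * h)" by (auto elim: oddE)
      ultimately have "large_prime p h" using elim by unfold_locales auto
      thus "[f p = g p] (mod int p)" by (rule assms)
    qed
  qed
  thus ?thesis by (simp add: adele_of.abs_eq adele.abs_eq_iff almost_cong_def)
qed

lemma adele_of_ops:
  "adele_of f + adele_of g = adele_of (\<lambda>p. f p + g p)"
  "adele_of f - adele_of g = adele_of (\<lambda>p. f p - g p)"
  "adele_of f * adele_of g = adele_of (\<lambda>p. f p * g p)"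
  "- adele_of f = adele_of (\<lambda>p. - f p)"
  by (simp_all add: adele_of.abs_eq plus_adele.abs_eq minus_adele.abs_eq times_adele.abs_eq
      uminus_adele.abs_eq)

lemma adele_of_int: "of_int c = adele_of (\<lambda>_. c)"
proof -
  have nat: "of_nat n = adele_of (\<lambda>_. int n)" for n
  proof (induction n)
    case 0
    show ?case by (simp add: adele_of.abs_eq zero_adele_def)
  next
    case (Suc n)
    have "(1::adele) = adele_of (\<lambda>_. 1)" by (simp add: adele_of.abs_eq one_adele_def)
    thus ?case using Suc adele_of_ops(1)[of "\<lambda>_. 1" "\<lambda>_. int n"] by simp
  qed
  show ?thesis by (cases c rule: int_cases2) (simp_all add: nat adele_of_ops)
qed

lemma adele_of_numeral:
  "1 = adele_of (\<lambda>_. 1)" "0 = adele_of (\<lambda>_. 0)"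
  "numeral n * adele_of f = adele_of (\<lambda>p. numeral n * f p)"
  using adele_of_int[of 1] adele_of_int[of 0] adele_of_int[of "numeral n"]
    adele_of_ops(3)[of "\<lambda>_. numeral n" f]
  by simp_all

definition weight1_value :: "int \<Rightarrow> int \<Rightarrow> adele" where
  "weight1_value \<epsilon> \<alpha> = M\<^sub>A [1] [\<epsilon>] [\<alpha>]"

definition weight2_value :: "int \<Rightarrow> int \<Rightarrow> adele" where
  "weight2_value \<epsilon> \<alpha> = M\<^sub>A [2] [\<epsilon>] [\<alpha>]"

definition double_value :: "int \<Rightarrow> int \<Rightarrow> int \<Rightarrow> int \<Rightarrow> adele" where
  "double_value \<epsilon> \<alpha> \<epsilon>' \<beta> = M\<^sub>A [1, 1] [\<epsilon>, \<epsilon>'] [\<alpha>, \<beta>]"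

lemma M_single:
  assumes "\<epsilon> \<in> {1, -1}"
  shows "M\<^sub>A [s] [\<epsilon>] [\<alpha>] = adele_of (\<lambda>p. \<Sum>k=1..p - 1. mixed_sign \<epsilon> \<alpha> k * pinv p k ^ s)"
  unfolding M\<^sub>A_def mixed_sum_single[OF assms]
proof (rule adele_of_eqI)
  fix p h assume "large_prime p h"
  then interpret large_prime p h .
  show "[residue p (\<Sum>k=1..p - 1. of_int (mixed_sign \<epsilon> \<alpha> k) * (1 / of_nat k) ^ s)
      = (\<Sum>k=1..p - 1. mixed_sign \<epsilon> \<alpha> k * pinv p k ^ s)] (mod int p)"
    by (intro represents_residue represents_sum represents_mult represents_of_int
        represents_power represents_pinv) (use p_eq in auto)
qed

lemma weight1_value_eq:
  "\<epsilon> \<in> {1, -1} \<Longrightarrow> weight1_value \<epsilon> \<alpha> = adele_of (\<lambda>p. \<Sum>k=1..p - 1. mixed_term p \<epsilon> \<alpha> k)"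
  by (simp only: weight1_value_def M_single mixed_term_def power_one_right)

lemma weight2_value_eq:
  "\<epsilon> \<in> {1, -1} \<Longrightarrow>
    weight2_value \<epsilon> \<alpha> = adele_of (\<lambda>p. \<Sum>k=1..p - 1. mixed_sign \<epsilon> \<alpha> k * pinv p k ^ 2)"
  by (simp only: weight2_value_def M_single)

lemma double_value_eq:
  assumes "\<epsilon> \<in> {1, -1}" "\<epsilon>' \<in> {1, -1}"
  shows "double_value \<epsilon> \<alpha> \<epsilon>' \<beta> = adele_of (\<lambda>p. dsum (p - 1) (mixed_term p \<epsilon> \<alpha>) (mixed_term p \<epsilon>' \<beta>))"
  unfolding double_value_def M\<^sub>A_def mixed_sum_double[OF assms]
proof (rule adele_of_eqI)
  fix p h assume "large_prime p h"
  then interpret large_prime p h .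
  show "[residue p (\<Sum>k=1..p - 1. of_int (mixed_sign \<epsilon> \<alpha> k) * (1 / of_nat k)
        * (\<Sum>l=1..<k. of_int (mixed_sign \<epsilon>' \<beta> l) * (1 / of_nat l)))
      = dsum (p - 1) (mixed_term p \<epsilon> \<alpha>) (mixed_term p \<epsilon>' \<beta>)] (mod int p)"
    unfolding dsum_def mixed_term_def
    by (intro represents_residue represents_sum represents_mult represents_of_int
        represents_pinv) (use p_eq in auto)
qed

section \<open>Relations in \<open>adele\<close>\<close>

lemma double_value_stuffle:
  assumes "\<epsilon> \<in> {1, -1}"
  shows "double_value \<epsilon> \<alpha> \<epsilon> \<beta> + double_value \<epsilon> \<beta> \<epsilon> \<alpha> + weight2_value \<epsilon> (\<alpha> * \<beta>)
    = weight1_value \<epsilon> \<alpha> * weight1_value \<epsilon> \<beta>"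
proof -
  have "mixed_sign \<epsilon> (\<alpha> * \<beta>) k * pinv p k ^ 2 = mixed_term p \<epsilon> \<alpha> k * mixed_term p \<epsilon> \<beta> k" for p k
    by (simp add: mixed_term_def power2_eq_square mult_ac flip: mixed_sign_mult)
  thus ?thesis
    by (simp only: double_value_eq weight1_value_eq weight2_value_eq assms adele_of_ops dsum_stuffle)
qed

text \<open>Indices of opposite parity never coincide, so the diagonal contributes nothing.\<close>

lemma double_value_stuffle_opposite:
  "double_value 1 \<alpha> (-1) \<beta> + double_value (-1) \<beta> 1 \<alpha> = weight1_value 1 \<alpha> * weight1_value (-1) \<beta>"
proof -
  have "(\<Sum>k=1..n. mixed_term p 1 \<alpha> k * mixed_term p (-1) \<beta> k) = 0" for p n
  proof (intro sum.neutral ballI)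
    show "mixed_term p 1 \<alpha> k * mixed_term p (-1) \<beta> k = 0" for k by (cases "even k") simp_all
  qed
  hence "dsum n (mixed_term p 1 \<alpha>) (mixed_term p (-1) \<beta>) + dsum n (mixed_term p (-1) \<beta>) (mixed_term p 1 \<alpha>)
      = (\<Sum>k=1..n. mixed_term p 1 \<alpha> k) * (\<Sum>k=1..n. mixed_term p (-1) \<beta> k)" for n p
    using dsum_stuffle[of n "mixed_term p 1 \<alpha>" "mixed_term p (-1) \<beta>"] by simp
  thus ?thesis by (simp add: double_value_eq weight1_value_eq adele_of_ops)
qed

text \<open>The factor picked up when an odd index is reflected to an even one; through \<alpha> =
  -1 it brings \<open>sign_A\<close> into the span.\<close>

definition reflection_sign_A :: "int \<Rightarrow> adele" where
  "reflection_sign_A \<alpha> = adele_of (\<lambda>p. reflection_sign \<alpha> ((p - 1) div 2))"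

lemma reflection_sign_A_simps [simp]:
  "reflection_sign_A 1 = -1" "reflection_sign_A (-1) = sign_A"
  by (simp_all add: reflection_sign_A_def sign_A_def adele_of_numeral(1) adele_of_ops)

lemma weight1_value_odd:
  assumes "\<alpha> \<in> {1, -1}"
  shows "weight1_value (-1) \<alpha> = reflection_sign_A \<alpha> * weight1_value 1 \<alpha>"
  unfolding weight1_value_eq[of "-1", simplified] weight1_value_eq[of 1, simplified]
    reflection_sign_A_def adele_of_ops
proof (rule adele_of_eqI, goal_cases)
  case (1 p h)
  then interpret large_prime p h .
  show ?case using sum_odd_reflect[OF assms] by (simp add: p_minus_1)
qed

lemma weight2_value_odd:
  assumes "\<alpha> \<in> {1, -1}"
  shows "weight2_value (-1) \<alpha> = - reflection_sign_A \<alpha> * weight2_value 1 \<alpha>"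
  unfolding weight2_value_eq[of "-1", simplified] weight2_value_eq[of 1, simplified]
    reflection_sign_A_def adele_of_ops
proof (rule adele_of_eqI, goal_cases)
  case (1 p h)
  then interpret large_prime p h .
  show ?case using sum_squares_odd_reflect[OF assms] by (simp add: p_minus_1)
qed

lemma double_value_odd_odd:
  assumes "\<alpha> \<in> {1, -1}" "\<beta> \<in> {1, -1}"
  shows "double_value (-1) \<alpha> (-1) \<beta>
    = reflection_sign_A \<alpha> * reflection_sign_A \<beta> * double_value 1 \<beta> 1 \<alpha>"
  unfolding double_value_eq[of "-1" "-1", simplified] double_value_eq[of 1 1, simplified]
    reflection_sign_A_def adele_of_ops
proof (rule adele_of_eqI, goal_cases)
  case (1 p h)
  then interpret large_prime p h .
  show ?case using dsum_odd_odd_reflect[OF assms] by (simp add: p_minus_1)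
qed

lemma double_value_even_odd:
  assumes "\<alpha> \<in> {1, -1}" "\<beta> \<in> {1, -1}"
  shows "double_value 1 \<alpha> (-1) \<beta> = reflection_sign_A \<beta> * (weight1_value 1 \<alpha> * weight1_value 1 \<beta>
    - double_value 1 \<beta> 1 (\<alpha> * \<beta>) - double_value 1 \<alpha> 1 (\<alpha> * \<beta>))"
  unfolding double_value_eq[of 1 "-1", simplified] double_value_eq[of 1 1, simplified]
    weight1_value_eq[of 1, simplified] reflection_sign_A_def adele_of_ops
proof (rule adele_of_eqI, goal_cases)
  case (1 p h)
  then interpret large_prime p h .
  show ?case using dsum_even_odd[OF assms] by (simp add: p_minus_1)
qed

lemma double_value_even_alternating:
  "4 * double_value 1 1 1 1 - 4 * double_value 1 1 1 (-1)
    = double_value 1 1 (-1) 1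
      + 2 * ((weight1_value 1 1 - weight1_value 1 (-1)) * (weight1_value 1 1 - weight1_value 1 (-1)))
      - 2 * (weight2_value 1 1 - weight2_value 1 (-1))"
  unfolding double_value_eq[of 1 "-1", simplified] double_value_eq[of 1 1, simplified]
    weight1_value_eq[of 1, simplified] weight2_value_eq[of 1, simplified] adele_of_ops adele_of_numeral
proof (rule adele_of_eqI, goal_cases)
  case (1 p h)
  then interpret large_prime p h .
  show ?case using dsum_even_alternating by (simp add: p_minus_1 power2_eq_square)
qed

lemma weight1_value_even: "weight1_value 1 1 = - q\<^sub>2" "2 * weight1_value 1 (-1) = - q\<^sub>2"
  unfolding weight1_value_eq[of 1, simplified] q\<^sub>2_def adele_of_ops adele_of_numeral
proof (rule_tac [!] adele_of_eqI, goal_cases)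
  case (1 p h)
  then interpret large_prime p h .
  show ?case using sum_even_fermat_quotient by (simp add: p_minus_1)
next
  case (2 p h)
  then interpret large_prime p h .
  show ?case using sum_even_alternating_fermat_quotient by (simp add: p_minus_1)
qed

section \<open>Rational scaling and spans\<close>

lemma adele_scale_of_nat: "adele_scale (of_nat n) x = of_nat n * x"
  by (induction n) (simp_all add: adele.scale_left_distrib distrib_right)

lemma adele_scale_numeral: "adele_scale (numeral n) x = numeral n * x"
  using adele_scale_of_nat[of "numeral n"] by simp

text \<open>Scalars are rational, so the factors 2, 4 and 6 left over by the congruences can be
  removed in \<open>adele\<close>.\<close>

lemma adele_scale_inverse_numeral: "adele_scale (1 / numeral n) (numeral n * x) = x"
  by (simp flip: adele_scale_numeral)

lemma numeral_mult_eq_0D: "numeral n * x = (0 :: adele) \<Longrightarrow> x = 0"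
  using adele_scale_inverse_numeral[of n x] by simp

lemma weight2_value_even: "weight2_value 1 1 = 0" "weight2_value 1 (-1) = sign_A * G\<^sub>A"
proof -
  have "6 * weight2_value 1 1 = 0"
    unfolding weight2_value_eq[of 1, simplified] adele_of_numeral
  proof (rule adele_of_eqI, goal_cases)
    case (1 p h)
    then interpret large_prime p h .
    show ?case using six_sum_squares_even by (simp add: p_minus_1)
  qed
  thus "weight2_value 1 1 = 0"
    by (rule numeral_mult_eq_0D)
  show "weight2_value 1 (-1) = sign_A * G\<^sub>A"
    unfolding weight2_value_eq[of 1, simplified] sign_A_def G\<^sub>A_def adele_of_ops
  proof (rule adele_of_eqI, goal_cases)
    case (1 p h)
    then interpret large_prime p h .
    show ?case using sum_squares_euler_number by (simp add: p_minus_1)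
  qed
qed

lemma sign_A_square: "sign_A * (sign_A * x) = x"
proof -
  have "sign_A * sign_A = 1"
    unfolding sign_A_def adele_of_ops adele_of_numeral(1) by (simp flip: power_mult_distrib)
  thus ?thesis by (simp flip: mult.assoc)
qed

lemma span_numeralD: "numeral n * x \<in> adele.span X \<Longrightarrow> x \<in> adele.span X"
  using adele.span_scale[of "numeral n * x" X "1 / numeral n"] by (simp add: adele_scale_inverse_numeral)

lemma span_numeral: "x \<in> adele.span X \<Longrightarrow> numeral n * x \<in> adele.span X"
  using adele.span_scale[of x X "numeral n"] by (simp add: adele_scale_numeral)

text \<open>Multiplication by \<open>sign_A\<close> is linear, so it suffices to look at the
  spanning set.\<close>

lemma span_sign_A:
  assumes "\<And>x. x \<in> X \<Longrightarrow> sign_A * x \<in> adele.span X" "x \<in> adele.span X"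
  shows "sign_A * x \<in> adele.span X"
  using assms(2)
proof (induction rule: adele.span_induct)
  case base
  have "sign_A * adele_scale c y = adele_scale c (sign_A * y)" for c y
    by (metis adele_scale_mult mult.commute)
  thus ?case
    by (auto simp: adele.subspace_def distrib_left adele.span_zero intro: adele.span_add adele.span_scale)
qed (use assms(1) in auto)

section \<open>Generators in weight 2 and the two inclusions\<close>

lemma weight_2_lists:
  assumes "sum_list s = 2" "set s \<subseteq> {0<..}"
  shows "s = [2] \<or> s = [1, 1 :: nat]"
proof (cases s)
  case (Cons a t)
  hence "a = 1 \<or> a = 2" using assms by auto
  moreover have "t = []" if "sum_list t = 0"
    using that assms(2) Cons by (cases t) auto
  moreover have "t = [1]" if "sum_list t = 1"
  proof (cases t)
    case (Cons b u)
    hence "b > 0" "b + sum_list u = 1" using that assms(2) \<open>s = a # t\<close> by simp_all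
    hence "b = 1" "sum_list u = 0" by linarith+
    moreover have "u = []" using \<open>sum_list u = 0\<close> assms(2) \<open>s = a # t\<close> Cons by (cases u) auto
    ultimately show ?thesis using Cons by simp
  qed (use that in simp)
  ultimately show ?thesis using assms(1) Cons by auto
qed (use assms in simp)

lemma FAMMV_2_generators:
  "FAMMV 2 = adele.span
    ({weight2_value \<epsilon> \<alpha> | \<epsilon> \<alpha>. {\<epsilon>, \<alpha>} \<subseteq> {1, -1}}
      \<union> {double_value \<epsilon> \<alpha> \<epsilon>' \<beta> | \<epsilon> \<alpha> \<epsilon>' \<beta>. {\<epsilon>, \<alpha>, \<epsilon>', \<beta>} \<subseteq> {1, -1}})"
  (is "_ = adele.span ?G")
proof -
  define F where "F = {M\<^sub>A s \<epsilon> \<sigma> | s \<epsilon> \<sigma>.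
     length \<epsilon> = length s \<and> length \<sigma> = length s \<and>
     set s \<subseteq> {0<..} \<and> set \<epsilon> \<subseteq> {1, -1} \<and> set \<sigma> \<subseteq> {1, -1} \<and> sum_list s = 2}"
  have "F \<subseteq> ?G"
  proof
    fix x assume "x \<in> F"
    then obtain s \<epsilon> \<sigma> where x: "x = M\<^sub>A s \<epsilon> \<sigma>"
      and *: "length \<epsilon> = length s" "length \<sigma> = length s" "set s \<subseteq> {0<..}"
        "set \<epsilon> \<subseteq> {1, -1}" "set \<sigma> \<subseteq> {1, -1}" "sum_list s = 2"
      by (auto simp: F_def)
    from weight_2_lists[OF *(6,3)] show "x \<in> ?G"
    proof
      assume s: "s = [2]"
      then obtain a c where ac: "\<epsilon> = [a]" "\<sigma> = [c]" using * by (auto simp: length_Suc_conv)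
      hence "x = weight2_value a c" "{a, c} \<subseteq> {1, -1}"
        using * x s by (auto simp: weight2_value_def)
      thus ?thesis by blast
    next
      assume s: "s = [1, 1]"
      then obtain a b c d where "\<epsilon> = [a, b]" "\<sigma> = [c, d]"
        using * by (auto simp: length_Suc_conv)
      \<comment> \<open>\<open>double_value\<close> lists the parity and the sign of each index
        together, hence the interleaved order.\<close>
      hence "x = double_value a c b d" "{a, c, b, d} \<subseteq> {1, -1}"
        using * x s by (auto simp: double_value_def)
      thus ?thesis by blast
    qed
  qed
  have w2: "weight2_value \<epsilon> \<alpha> \<in> F" if "{\<epsilon>, \<alpha>} \<subseteq> {1, -1}" for \<epsilon> \<alpha>
    unfolding F_def weight2_value_def mem_Collect_eq
    by (rule exI[of _ "[2]"], rule exI[of _ "[\<epsilon>]"], rule exI[of _ "[\<alpha>]"]) (use that in simp)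
  have dv: "double_value \<epsilon> \<alpha> \<epsilon>' \<beta> \<in> F" if "{\<epsilon>, \<alpha>, \<epsilon>', \<beta>} \<subseteq> {1, -1}" for \<epsilon> \<alpha> \<epsilon>' \<beta>
    unfolding F_def double_value_def mem_Collect_eq
    by (rule exI[of _ "[1, 1]"], rule exI[of _ "[\<epsilon>, \<epsilon>']"], rule exI[of _ "[\<alpha>, \<beta>]"])
      (use that in simp)
  have "?G \<subseteq> F"
  proof
    fix x assume "x \<in> ?G"
    thus "x \<in> F"
      by (elim UnE CollectE exE conjE) (hypsubst, erule w2 dv)+
  qed
  with \<open>F \<subseteq> ?G\<close> have "F = ?G" by (rule subset_antisym)
  thus ?thesis by (simp only: FAMMV_def F_def)
qed

text \<open>The weight 1 values over even indices are \<open>q\<^sub>2\<close> times -1 and -1/2, so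
  each product is a rational multiple of \<open>q\<^sub>2\<^sup>2\<close>; the factor 4 clears
  denominators.\<close>

lemma weight1_product_in_span:
  assumes "q\<^sub>2\<^sup>2 \<in> adele.span X" "\<alpha> \<in> {1, -1}" "\<beta> \<in> {1, -1}"
  shows "weight1_value 1 \<alpha> * weight1_value 1 \<beta> \<in> adele.span X"
proof -
  have two: "2 * weight1_value 1 \<gamma> = - q\<^sub>2 \<or> 2 * weight1_value 1 \<gamma> = - (2 * q\<^sub>2)" if "\<gamma> \<in> {1, -1}" for \<gamma>
    using that weight1_value_even by auto
  have "4 * (weight1_value 1 \<alpha> * weight1_value 1 \<beta>)
      = (2 * weight1_value 1 \<alpha>) * (2 * weight1_value 1 \<beta>)" by simp
  also have "\<dots> \<in> {q\<^sub>2\<^sup>2, 2 * q\<^sub>2\<^sup>2, 4 * q\<^sub>2\<^sup>2}"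
    using two[OF assms(2)] two[OF assms(3)]
    by (elim disjE) (simp_all only: minus_mult_minus, simp_all add: power2_eq_square)
  finally have "4 * (weight1_value 1 \<alpha> * weight1_value 1 \<beta>) \<in> adele.span X"
    using span_numeral[OF assms(1)] assms(1) by auto
  thus ?thesis by (rule span_numeralD)
qed

lemma FAMMV_2_subset: "FAMMV 2 \<subseteq> adele.span {q\<^sub>2\<^sup>2, G\<^sub>A, sign_A * q\<^sub>2\<^sup>2, sign_A * G\<^sub>A}"
proof -
  let ?X = "{q\<^sub>2\<^sup>2, G\<^sub>A, sign_A * q\<^sub>2\<^sup>2, sign_A * G\<^sub>A}"
  let ?V = "adele.span ?X"
  \<comment> \<open>\<open>sign_A\<close> is its own inverse and therefore permutes the four
    spanning elements.\<close>
  have sign: "sign_A * x \<in> ?V" if "x \<in> ?V" for x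
    by (rule span_sign_A[OF _ that]) (auto simp: sign_A_square intro: adele.span_base)
  have reflect: "reflection_sign_A \<alpha> * x \<in> ?V" if "\<alpha> \<in> {1, -1}" "x \<in> ?V" for \<alpha> x
    using that sign[of x] adele.span_neg[of x ?X] by auto
  have prod: "weight1_value 1 \<alpha> * weight1_value 1 \<beta> \<in> ?V" if "\<alpha> \<in> {1, -1}" "\<beta> \<in> {1, -1}" for \<alpha> \<beta>
    using that by (intro weight1_product_in_span adele.span_base) auto
  have w2_even: "weight2_value 1 \<alpha> \<in> ?V" if "\<alpha> \<in> {1, -1}" for \<alpha>
    using that by (auto simp: weight2_value_even intro: adele.span_zero adele.span_base)
  have w2: "weight2_value \<epsilon> \<alpha> \<in> ?V" if "{\<epsilon>, \<alpha>} \<subseteq> {1, -1}" for \<epsilon> \<alpha>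
  proof -
    have \<alpha>: "\<alpha> \<in> {1, -1}" using that by simp
    show ?thesis
      using that w2_even[OF \<alpha>] adele.span_neg[OF reflect[OF \<alpha> w2_even[OF \<alpha>]]]
      by (auto simp: weight2_value_odd)
  qed
  \<comment> \<open>With equal signs the two double values in the stuffle product coincide.\<close>
  have diag: "double_value 1 \<alpha> 1 \<alpha> \<in> ?V" if "\<alpha> \<in> {1, -1}" for \<alpha>
  proof -
    have "2 * double_value 1 \<alpha> 1 \<alpha> = weight1_value 1 \<alpha> * weight1_value 1 \<alpha> - weight2_value 1 (\<alpha> * \<alpha>)"
      by (simp flip: double_value_stuffle)
    also have "\<dots> \<in> ?V" using that by (intro adele.span_diff prod w2_even) auto
    finally show ?thesis by (rule span_numeralD)
  qed
  \<comment> \<open>For signs 1 and 1 the even-odd formula involves only the diagonal double value,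
    so this membership is available before the alternating double value and serves to obtain
    it.\<close>
  have "double_value 1 1 (-1) 1 \<in> ?V"
    using double_value_even_odd[of 1 1] prod[of 1 1] diag[of 1]
    by (auto intro!: adele.span_diff adele.span_neg span_numeral)
  moreover have "(weight1_value 1 1 - weight1_value 1 (-1)) * (weight1_value 1 1 - weight1_value 1 (-1)) \<in> ?V"
    unfolding left_diff_distrib right_diff_distrib by (intro adele.span_diff prod) auto
  ultimately have "4 * double_value 1 1 1 1 - 4 * double_value 1 1 1 (-1) \<in> ?V"
    unfolding double_value_even_alternating
    by (intro adele.span_add adele.span_diff span_numeral w2_even) auto
  moreover have "4 * double_value 1 1 1 1 \<in> ?V" by (intro span_numeral diag) simp
  ultimately have "4 * double_value 1 1 1 (-1) \<in> ?V" using adele.span_diff by fastforce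
  hence alt: "double_value 1 1 1 (-1) \<in> ?V" by (rule span_numeralD)
  \<comment> \<open>The stuffle product exchanges the two signs.\<close>
  have "double_value 1 (-1) 1 1
      = weight1_value 1 1 * weight1_value 1 (-1) - weight2_value 1 (1 * -1) - double_value 1 1 1 (-1)"
    by (simp flip: double_value_stuffle[of 1 1 "-1"])
  hence "double_value 1 (-1) 1 1 \<in> ?V"
    using alt prod[of 1 "-1"] w2_even[of "-1"] by (simp add: adele.span_diff)
  hence even_even: "double_value 1 \<alpha> 1 \<beta> \<in> ?V" if "\<alpha> \<in> {1, -1}" "\<beta> \<in> {1, -1}" for \<alpha> \<beta>
    using that alt diag by auto
  have even_odd: "double_value 1 \<alpha> (-1) \<beta> \<in> ?V" if "\<alpha> \<in> {1, -1}" "\<beta> \<in> {1, -1}" for \<alpha> \<beta>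
    unfolding double_value_even_odd[OF that] using that
    by (intro reflect adele.span_diff prod even_even) auto
  have odd_even: "double_value (-1) \<beta> 1 \<alpha> \<in> ?V" if "\<alpha> \<in> {1, -1}" "\<beta> \<in> {1, -1}" for \<alpha> \<beta>
  proof -
    have "double_value (-1) \<beta> 1 \<alpha>
        = weight1_value 1 \<alpha> * weight1_value (-1) \<beta> - double_value 1 \<alpha> (-1) \<beta>"
      by (simp flip: double_value_stuffle_opposite)
    also have "\<dots> = reflection_sign_A \<beta> * (weight1_value 1 \<alpha> * weight1_value 1 \<beta>) - double_value 1 \<alpha> (-1) \<beta>"
      by (simp add: weight1_value_odd[OF that(2)] mult.left_commute)
    also have "\<dots> \<in> ?V" using that by (intro adele.span_diff reflect prod even_odd)
    finally show ?thesis .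
  qed
  have odd_odd: "double_value (-1) \<alpha> (-1) \<beta> \<in> ?V" if "\<alpha> \<in> {1, -1}" "\<beta> \<in> {1, -1}" for \<alpha> \<beta>
    unfolding double_value_odd_odd[OF that] mult.assoc using that by (intro reflect even_even)
  have dv: "double_value \<epsilon> \<alpha> \<epsilon>' \<beta> \<in> ?V" if "{\<epsilon>, \<alpha>, \<epsilon>', \<beta>} \<subseteq> {1, -1}" for \<epsilon> \<alpha> \<epsilon>' \<beta>
  proof -
    have "\<alpha> \<in> {1, -1}" "\<beta> \<in> {1, -1}" "\<epsilon> = 1 \<or> \<epsilon> = -1" "\<epsilon>' = 1 \<or> \<epsilon>' = -1"
      using that by auto
    thus ?thesis
      using even_even[of \<alpha> \<beta>] even_odd[of \<alpha> \<beta>] odd_even[of \<beta> \<alpha>] odd_odd[of \<alpha> \<beta>] by metis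
  qed
  thus ?thesis unfolding FAMMV_2_generators
    by (intro adele.span_minimal adele.subspace_span subsetI, elim UnE CollectE exE conjE)
      (hypsubst, erule w2 dv)+
qed

lemma FAMMV_2_superset: "adele.span {q\<^sub>2\<^sup>2, G\<^sub>A, sign_A * q\<^sub>2\<^sup>2, sign_A * G\<^sub>A} \<subseteq> FAMMV 2"
proof -
  have w2: "weight2_value \<epsilon> \<alpha> \<in> FAMMV 2" if "{\<epsilon>, \<alpha>} \<subseteq> {1, -1}" for \<epsilon> \<alpha>
    unfolding FAMMV_2_generators using that by (intro adele.span_base) blast
  have dv: "double_value \<epsilon> \<alpha> \<epsilon>' \<beta> \<in> FAMMV 2" if "{\<epsilon>, \<alpha>, \<epsilon>', \<beta>} \<subseteq> {1, -1}" for \<epsilon> \<alpha> \<epsilon>' \<beta>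
    unfolding FAMMV_2_generators using that by (intro adele.span_base) blast
  note closed = adele.span_add adele.span_diff adele.span_neg span_numeral
  \<comment> \<open>The stuffle product for the square of the weight 1 value
    \<open>- q\<^sub>2\<close>.\<close>
  have "q\<^sub>2\<^sup>2 = 2 * double_value 1 1 1 1 + weight2_value 1 1"
    using double_value_stuffle[of 1 1 1] by (simp add: weight1_value_even power2_eq_square)
  hence "q\<^sub>2\<^sup>2 \<in> FAMMV 2"
    using dv[of 1 1 1 1] w2[of 1 1] unfolding FAMMV_def by (auto intro!: closed)
  moreover have "sign_A * G\<^sub>A \<in> FAMMV 2"
    using w2[of 1 "-1"] by (simp add: weight2_value_even)
  \<comment> \<open>Reflection brings a second \<open>sign_A\<close>, which cancels the one in the
    even value.\<close>
  moreover have "- G\<^sub>A \<in> FAMMV 2"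
    using w2[of "-1" "-1"] by (simp add: weight2_value_odd weight2_value_even sign_A_square)
  hence "G\<^sub>A \<in> FAMMV 2" using adele.span_neg unfolding FAMMV_def by fastforce
  moreover have "sign_A * q\<^sub>2\<^sup>2 \<in> FAMMV 2"
  proof -
    \<comment> \<open>The product of an even and an odd weight 1 value is a sum of two double
      values, and reflecting the odd factor supplies \<open>sign_A\<close>.\<close>
    have "4 * (weight1_value 1 (-1) * weight1_value (-1) (-1))
        = sign_A * ((2 * weight1_value 1 (-1)) * (2 * weight1_value 1 (-1)))"
      by (simp add: weight1_value_odd mult_ac)
    also have "\<dots> = sign_A * q\<^sub>2\<^sup>2" by (simp add: weight1_value_even power2_eq_square)
    finally have "sign_A * q\<^sub>2\<^sup>2 = 4 * (double_value 1 (-1) (-1) (-1) + double_value (-1) (-1) 1 (-1))"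
      by (simp add: double_value_stuffle_opposite)
    thus ?thesis
      using dv[of 1 "-1" "-1" "-1"] dv[of "-1" "-1" 1 "-1"] unfolding FAMMV_def
      by (auto intro!: closed)
  qed
  moreover have "adele.subspace (FAMMV 2)" unfolding FAMMV_def by (rule adele.subspace_span)
  ultimately show ?thesis by (intro adele.span_minimal) auto
qed

theorem theorem4p5:
  shows "FAMMV 2 = adele.span {q\<^sub>2\<^sup>2, G\<^sub>A, sign_A * q\<^sub>2\<^sup>2, sign_A * G\<^sub>A}"
  using FAMMV_2_subset FAMMV_2_superset by (rule subset_antisym)

end
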